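(* Let $m,n\ge 1$. For any positive integer $\ell$, the set of multiplicatively dense $\ell$-tuples of $H_{mn}$ is dense in the set of nonseparated $\ell$-tuples of $H_{mn}$ (both regarded as subsets of $H_{mn}^{\ell}$ with the product topology).
   Context: For integers $m,n\ge 1$, $H_{mn}=\mathbb{R}^{m-1}\times\mathbb{R}\times\mathbb{R}^n$ denotes the simply connected Lie group (with the usual manifold structure) with product $(v,a,\mathbf b)(v',a',\mathbf b')=(v+v',\,a+a',\,\mathbf b+e^{a}\mathbf b')$, where $v,v'\in\mathbb{R}^{m-1}$, $a,a'\in\mathbb{R}$, $\mathbf b,\mathbf b'\in\mathbb{R}^n$. A maximal subsemigroup of a topological group $G$ (always understood: with nonempty interior) is a proper subsemigroup $M$ of $G$ with nonempty interior such that $M$ is not a group and the only subsemigroups of $G$ containing $M$ are $G$ and $M$. A subset $S$ of $G$ is nonseparated if it is not contained in any maximal subsemigroup of $G$, and is multiplicatively dense if the subsemigroup it generates is dense in $G$. An $\ell$-tuple $p\in G^{\ell}$ is called nonseparated (respectively multiplicatively dense) if the subset of $G$ formed by its entries is nonseparated (respectively multiplicatively dense). *)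

theory Defs
  imports "HOL-Analysis.Analysis" "HOL-Algebra.Group"
begin

text \<open>
  A topological group is given by a HOL-Algebra group \<open>G\<close> together with a topology \<open>T\<close> whose
  topspace is \<open>carrier G\<close>.
\<close>

definition subsemigroup :: "('a, 'b) monoid_scheme \<Rightarrow> 'a set \<Rightarrow> bool" where
  "subsemigroup G M \<longleftrightarrow>
     M \<subseteq> carrier G \<and> (\<forall>x\<in>M. \<forall>y\<in>M. x \<otimes>\<^bsub>G\<^esub> y \<in> M)"

definition maximal_subsemigroup ::
    "('a, 'b) monoid_scheme \<Rightarrow> 'a topology \<Rightarrow> 'a set \<Rightarrow> bool" where
  "maximal_subsemigroup G T M \<longleftrightarrow>
     subsemigroup G M \<and> M \<noteq> carrier G \<and> T interior_of M \<noteq> {} \<and> \<not> subgroup M G \<and>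
     (\<forall>N. subsemigroup G N \<and> M \<subseteq> N \<longrightarrow> N = carrier G \<or> N = M)"

definition nonseparated :: "('a, 'b) monoid_scheme \<Rightarrow> 'a topology \<Rightarrow> 'a set \<Rightarrow> bool" where
  "nonseparated G T S \<longleftrightarrow> \<not> (\<exists>M. maximal_subsemigroup G T M \<and> S \<subseteq> M)"

definition multiplicatively_dense ::
    "('a, 'b) monoid_scheme \<Rightarrow> 'a topology \<Rightarrow> 'a set \<Rightarrow> bool" where
  "multiplicatively_dense G T S \<longleftrightarrow> T closure_of (subsemigroup G hull S) = carrier G"

text \<open>
  An \<open>l\<close>-tuple is an extensional function on \<open>{..<l}\<close>, so that the space of
  \<open>l\<close>-tuples is the topspace of the following product topology.
\<close>

definition tuple_topology :: "'a topology \<Rightarrow> nat \<Rightarrow> (nat \<Rightarrow> 'a) topology" where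
  "tuple_topology T l = product_topology (\<lambda>_. T) {..<l}"

definition nonseparated_tuples ::
    "('a, 'b) monoid_scheme \<Rightarrow> 'a topology \<Rightarrow> nat \<Rightarrow> (nat \<Rightarrow> 'a) set" where
  "nonseparated_tuples G T l =
     {p \<in> topspace (tuple_topology T l). nonseparated G T (p ` {..<l})}"

definition multiplicatively_dense_tuples ::
    "('a, 'b) monoid_scheme \<Rightarrow> 'a topology \<Rightarrow> nat \<Rightarrow> (nat \<Rightarrow> 'a) set" where
  "multiplicatively_dense_tuples G T l =
     {p \<in> topspace (tuple_topology T l). multiplicatively_dense G T (p ` {..<l})}"

text \<open>
  The dimensions are natural numbers and \<open>m - 1\<close> may be \<open>0\<close>, so \<open>\<real>\<^sup>k\<close> is taken to be
  \<^const>\<open>Euclidean_space\<close> \<open>k\<close>, the real sequences vanishing from index \<open>k\<close> on.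
  The definitions are meaningful for \<open>m \<ge> 1\<close> only.
\<close>

definition H_topology :: "nat \<Rightarrow> nat \<Rightarrow> ((nat \<Rightarrow> real) \<times> real \<times> (nat \<Rightarrow> real)) topology" where
  "H_topology m n =
     prod_topology (Euclidean_space (m - 1)) (prod_topology euclideanreal (Euclidean_space n))"

definition H_group :: "nat \<Rightarrow> nat \<Rightarrow> ((nat \<Rightarrow> real) \<times> real \<times> (nat \<Rightarrow> real)) monoid" where
  "H_group m n =
     \<lparr>carrier = topspace (H_topology m n),
      mult = (\<lambda>(v, a, b) (v', a', b').
        ((\<lambda>i. v i + v' i), a + a', (\<lambda>i. b i + exp a * b' i))),
      one = ((\<lambda>_. 0), 0, (\<lambda>_. 0))\<rparr>"

lemma topspace_H_topology: "topspace (H_topology m n) = carrier (H_group m n)"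
  by (simp add: H_group_def)

lemma group_H_group: "group (H_group m n)"
proof (rule groupI)
  fix x assume "x \<in> carrier (H_group m n)"
  moreover obtain v a b where "x = (v, a, b)" by (cases x) auto
  ultimately show "\<exists>y\<in>carrier (H_group m n). y \<otimes>\<^bsub>H_group m n\<^esub> x = \<one>\<^bsub>H_group m n\<^esub>"
    by (intro bexI[where x = "(\<lambda>i. - v i, - a, \<lambda>i. - exp (- a) * b i)"])
      (auto simp: H_group_def H_topology_def topspace_Euclidean_space)
qed (auto simp: H_group_def H_topology_def topspace_Euclidean_space algebra_simps exp_add)

end

theory Submission
  imports Defs "HOL-Real_Asymp.Real_Asymp"
begin

text \<open>
  An element \<open>(v, a, b)\<close> of the group acts on \<open>\<real>\<^sup>n\<close> as the homothety \<open>x \<mapsto> b + exp a * x\<close>, and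
  \<open>(v, a)\<close> is its image in the abelianisation \<open>\<real>\<^sup>m\<close>.

  That dense tuples are nonseparated holds because a dense subsemigroup with nonempty interior is
  the whole group (\<open>multiplicatively_dense_imp_nonseparated\<close>). For the converse approximation, two kinds of
  maximal subsemigroups suffice: the elements on one side of a hyperplane of \<open>\<real>\<^sup>m\<close>, and the elements
  that map a given half-space of \<open>\<real>\<^sup>n\<close> into itself. A nonseparated tuple is contained in none of
  them. The first kind yields, by convex separation, a relation with strictly positive weights
  among the images of the entries in \<open>\<real>\<^sup>m\<close>, which moreover positively span \<open>\<real>\<^sup>m\<close>; the second kind
  says that every half-space of \<open>\<real>\<^sup>n\<close> is moved out of itself by some entry.

  Both conditions are unaffected by replacing the entries by positive fractional powers, and
  exponents arbitrarily close to \<open>1\<close> can be chosen such that the weights of the positive relation become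
  rationally independent. The resulting tuples are multiplicatively dense. Indeed, by Kronecker's
  theorem there are products whose images approach any given point of \<open>\<real>\<^sup>m\<close>. Starting such products
  with a high power of a contraction and ending them with a high power of an expansion keeps their
  translation parts under control and determines their limits (\<open>limit_of_words\<close>). These limits
  generate enough: the possible translation parts form a set that is stable under the tuple and whose
  cone, seen from one point, is convex. A proper cone would give a half-space mapped into itself by every
  entry, so the set is all of \<open>\<real>\<^sup>n\<close> (\<open>closed_subsemigroup_eq_carrier\<close>).
\<close>

section \<open>Separation of convex cones\<close>

text \<open>
  Hahn--Banach for sublinear functionals of the first \<open>n\<close> coordinates of a sequence. The dimension
  occurs here as a natural number and is the induction variable, so the vectors are sequences of
  which only the entries below \<open>n\<close> matter. Assigning to the last unit vector \<open>e\<close> the largest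
  admissible value \<open>c = q e\<close> leaves the functional \<open>x \<mapsto> inf\<^sub>t (q (x + t e) - t c)\<close>, which is again
  sublinear and no longer sees the last coordinate.\<close>
lemma dominated_linear_functional:
  fixes q :: "(nat \<Rightarrow> real) \<Rightarrow> real"
  assumes "\<And>x y. q (\<lambda>i. x i + y i) \<le> q x + q y"
    and "\<And>t x. t > 0 \<Longrightarrow> q (\<lambda>i. t * x i) \<le> t * q x"
    and "\<And>x y. (\<And>i. i < n \<Longrightarrow> x i = y i) \<Longrightarrow> q x = q y"
  shows "\<exists>\<psi>. \<forall>x. (\<Sum>i<n. \<psi> i * x i) \<le> q x"
  using assms
proof (induction n arbitrary: q)
  case 0
  have "q x \<ge> 0" for x
  proof -
    have "q x = q (\<lambda>i. x i + x i)" by (rule "0.prems"(3)) simp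
    with "0.prems"(1)[of x x] show ?thesis by simp
  qed
  then show ?case by simp
next
  case (Suc n)
  note sub = Suc.prems(1) and hom = Suc.prems(2) and cong = Suc.prems(3)
  define e :: "nat \<Rightarrow> real" where "e = (\<lambda>i. if i = n then 1 else 0)"
  define c where "c = q e"
  define F where "F x s = q (x(n := s)) - s * c" for x :: "nat \<Rightarrow> real" and s
  define q' where "q' x = (INF s. F x s)" for x
  have q0: "q (\<lambda>i. 0) = 0"
    using hom[of 2 "\<lambda>i. 0"] hom[of "1/2" "\<lambda>i. 0"] by simp
  have qe: "q (\<lambda>i. s * e i) \<ge> s * c" for s
  proof -
    consider "s > 0" | "s = 0" | "s < 0" by linarith
    then show ?thesis
    proof cases
      case 1
      then have "c \<le> (1 / s) * q (\<lambda>i. s * e i)"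
        using hom[of "1 / s" "\<lambda>i. s * e i"] by (simp add: c_def)
      with 1 show ?thesis by (simp add: field_simps)
    next
      case 2 then show ?thesis using q0 by simp
    next
      case 3
      have "0 \<le> q (\<lambda>i. s * e i) + q (\<lambda>i. (- s) * e i)"
        using sub[of "\<lambda>i. s * e i" "\<lambda>i. (- s) * e i"] q0 by simp
      also have "\<dots> \<le> q (\<lambda>i. s * e i) + (- s) * c"
        using hom[of "- s" e] 3 unfolding c_def by linarith
      finally show ?thesis by simp
    qed
  qed
  have low: "F x s \<ge> - q ((\<lambda>i. - x i)(n := 0))" for x s
  proof -
    have "s * c \<le> q (\<lambda>i. s * e i)" by (rule qe)
    also have "(\<lambda>i. s * e i) = (\<lambda>i. (x(n := s)) i + ((\<lambda>i. - x i)(n := 0)) i)"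
      by (auto simp: e_def)
    also have "q \<dots> \<le> q (x(n := s)) + q ((\<lambda>i. - x i)(n := 0))" by (rule sub)
    finally show ?thesis by (simp add: F_def)
  qed
  then have bdd: "bdd_below (range (F x))" for x
    by (intro bdd_belowI) auto
  have q'_le: "q' x \<le> F x s" for x s
    unfolding q'_def by (intro cINF_lower bdd) auto
  have q'_ge: "r \<le> q' x" if "\<And>s. r \<le> F x s" for r x
    unfolding q'_def by (rule cINF_greatest) (use that in auto)
  have "\<exists>\<psi>. \<forall>x. (\<Sum>i<n. \<psi> i * x i) \<le> q' x"
  proof (rule Suc.IH)
    fix x y :: "nat \<Rightarrow> real"
    have *: "q' (\<lambda>i. x i + y i) \<le> F x s + F y s'" for s s'
    proof -
      have "q' (\<lambda>i. x i + y i) \<le> F (\<lambda>i. x i + y i) (s + s')" by (rule q'_le)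
      also have "(\<lambda>i. x i + y i)(n := s + s') = (\<lambda>i. (x(n := s)) i + (y(n := s')) i)"
        by auto
      then have "F (\<lambda>i. x i + y i) (s + s') \<le> F x s + F y s'"
        using sub[of "x(n := s)" "y(n := s')"]
        by (simp add: F_def algebra_simps del: fun_upd_apply)
      finally show ?thesis .
    qed
    have "q' (\<lambda>i. x i + y i) - F x s \<le> q' y" for s
      by (rule q'_ge) (use *[of s] in \<open>simp add: algebra_simps\<close>)
    then have "q' (\<lambda>i. x i + y i) - q' y \<le> q' x"
      by (intro q'_ge) (simp add: algebra_simps)
    then show "q' (\<lambda>i. x i + y i) \<le> q' x + q' y" by simp
  next
    fix t :: real and x :: "nat \<Rightarrow> real" assume t: "t > 0"
    have "q' (\<lambda>i. t * x i) / t \<le> F x s" for s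
    proof -
      have "q' (\<lambda>i. t * x i) \<le> F (\<lambda>i. t * x i) (t * s)" by (rule q'_le)
      also have "(\<lambda>i. t * x i)(n := t * s) = (\<lambda>i. t * (x(n := s)) i)" by auto
      then have "F (\<lambda>i. t * x i) (t * s) \<le> t * F x s"
        using hom[OF t, of "x(n := s)"] by (simp add: F_def algebra_simps del: fun_upd_apply)
      finally show ?thesis using t by (simp add: field_simps)
    qed
    then have "q' (\<lambda>i. t * x i) / t \<le> q' x" by (rule q'_ge)
    then show "q' (\<lambda>i. t * x i) \<le> t * q' x" using t by (simp add: field_simps)
  next
    fix x y :: "nat \<Rightarrow> real" assume "\<And>i. i < n \<Longrightarrow> x i = y i"
    then have "F x = F y"
      unfolding F_def by (intro ext arg_cong2[where f="(-)"] cong) auto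
    then show "q' x = q' y" by (simp add: q'_def)
  qed
  then obtain \<psi> where \<psi>: "\<And>x. (\<Sum>i<n. \<psi> i * x i) \<le> q' x" by blast
  have "(\<Sum>i<Suc n. (\<psi>(n := c)) i * x i) \<le> q x" for x
    using order_trans[OF \<psi>[of x] q'_le[of x "x n"]] by (simp add: F_def algebra_simps)
  then show ?case by blast
qed

text \<open>
  The cone may be neither open nor closed, hence the weak inequality. Forgetting the last
  coordinate, either the projected cone still misses a point, and the induction hypothesis applies,
  or it is everything. In the latter
  case the fibre over \<open>0\<close> lies on one side of \<open>0\<close>, so that the lower (or upper) boundary of the cone
  is the graph of a finite sublinear functional, and a linear functional below it gives the
  half-space.\<close>
lemma convex_cone_in_halfspace:
  fixes C :: "(nat \<Rightarrow> real) set"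
  assumes "\<And>x y. x \<in> C \<Longrightarrow> y \<in> C \<Longrightarrow> (\<lambda>i. x i + y i) \<in> C"
    and "\<And>t x. t > 0 \<Longrightarrow> x \<in> C \<Longrightarrow> (\<lambda>i. t * x i) \<in> C"
    and "C \<noteq> {}"
    and "\<And>x. x \<in> C \<Longrightarrow> \<exists>i<n. x i \<noteq> z i"
  shows "\<exists>\<phi>. (\<exists>i<n. \<phi> i \<noteq> 0) \<and> (\<forall>x\<in>C. (\<Sum>i<n. \<phi> i * x i) \<ge> 0)"
  using assms
proof (induction n arbitrary: C z)
  case 0
  then show ?case by blast
next
  case (Suc n)
  note add = Suc.prems(1) and scale = Suc.prems(2) and ne = Suc.prems(3) and z = Suc.prems(4)
  show ?case
  proof (cases "\<exists>z. \<forall>x\<in>C. \<exists>i<n. x i \<noteq> z i")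
    case True
    then obtain z' where "\<And>x. x \<in> C \<Longrightarrow> \<exists>i<n. x i \<noteq> z' i" by blast
    from Suc.IH[OF add scale ne this]
    obtain \<phi> where \<phi>: "\<exists>i<n. \<phi> i \<noteq> 0" "\<forall>x\<in>C. (\<Sum>i<n. \<phi> i * x i) \<ge> 0" by blast
    show ?thesis
    proof (intro exI[of _ "\<phi>(n := 0)"] conjI)
      show "\<exists>i<Suc n. (\<phi>(n := 0)) i \<noteq> 0"
        using \<phi>(1) by (metis fun_upd_other less_SucI less_irrefl)
    qed (use \<phi>(2) in simp)
  next
    case False
    define A where "A x = {y n |y. y \<in> C \<and> (\<forall>i<n. y i = x i)}" for x :: "nat \<Rightarrow> real"
    have A_ne: "A x \<noteq> {}" for x
      using False by (auto simp: A_def)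
    have A_add: "s + s' \<in> A w"
      if "s \<in> A x" "s' \<in> A y" "\<And>i. i < n \<Longrightarrow> w i = x i + y i" for s s' x y w
    proof -
      from that obtain a b where "a \<in> C" "b \<in> C" "s = a n" "s' = b n"
        "\<forall>i<n. a i = x i" "\<forall>i<n. b i = y i" by (auto simp: A_def)
      then show ?thesis
        using that(3) add[of a b] unfolding A_def
        by (auto intro!: exI[of _ "\<lambda>i. a i + b i"])
    qed
    have A_scale: "t * s \<in> A w"
      if "s \<in> A x" "t > 0" "\<And>i. i < n \<Longrightarrow> w i = t * x i" for s t x w
    proof -
      from that obtain a where "a \<in> C" "s = a n" "\<forall>i<n. a i = x i" by (auto simp: A_def)
      then show ?thesis
        using that scale[of t a] unfolding A_def
        by (auto intro!: exI[of _ "\<lambda>i. t * a i"])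
    qed
    let ?o = "\<lambda>i::nat. 0::real"
    have not_both: "\<not> (s > 0 \<and> s' < 0)" if s: "s \<in> A ?o" and s': "s' \<in> A ?o" for s s'
    proof
      assume sgn: "s > 0 \<and> s' < 0"
      obtain r where r: "r \<in> A z" using A_ne by blast
      define d where "d = z n - r"
      have "d \<in> A ?o"
      proof -
        consider "d > 0" | "d < 0" | "d = 0" by linarith
        then show ?thesis
        proof cases
          case 1
          then show ?thesis using A_scale[OF s, of "d / s" ?o] sgn by simp
        next
          case 2
          then show ?thesis using A_scale[OF s', of "d / s'" ?o] sgn by (simp add: zero_less_divide_iff)
        next
          case 3
          have "(- s') * s + s * s' \<in> A ?o"
            using A_scale[OF s, of "- s'" ?o] A_scale[OF s', of s ?o] sgn
            by (intro A_add[where x = ?o and y = ?o]) auto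
          then show ?thesis using 3 by simp
        qed
      qed
      then have "r + d \<in> A z" using A_add[OF r, of d ?o z] by simp
      then obtain y where "y \<in> C" "\<forall>i<n. y i = z i" "y n = z n"
        by (auto simp: A_def d_def)
      then show False using z[of y] less_Suc_eq by auto
    qed
    \<comment> \<open>The sign \<open>\<sigma>\<close> treats the cones above and below their boundary graph simultaneously.\<close>
    have "\<exists>\<sigma>::real. \<sigma>\<^sup>2 = 1 \<and> (\<forall>s\<in>A ?o. 0 \<le> \<sigma> * s)"
    proof (cases "\<forall>s\<in>A ?o. 0 \<le> s")
      case True
      then show ?thesis by (intro exI[of _ 1]) auto
    next
      case False
      then have "\<forall>s\<in>A ?o. s \<le> 0" using not_both by (meson not_le)
      then show ?thesis by (intro exI[of _ "-1"]) auto
    qed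
    then obtain \<sigma> :: real where \<sigma>2: "\<sigma>\<^sup>2 = 1" and \<sigma>: "\<And>s. s \<in> A ?o \<Longrightarrow> 0 \<le> \<sigma> * s" by blast
    define q where "q x = Inf ((*) \<sigma> ` A x)" for x
    have bdd: "bdd_below ((*) \<sigma> ` A x)" for x
    proof -
      obtain r where r: "r \<in> A (\<lambda>i. - x i)" using A_ne by blast
      have "\<sigma> * s \<ge> - \<sigma> * r" if "s \<in> A x" for s
        using \<sigma>[OF A_add[OF that r, of ?o]] by (simp add: algebra_simps)
      then show ?thesis by (intro bdd_belowI) auto
    qed
    have q_le: "q x \<le> \<sigma> * s" if "s \<in> A x" for x s
      unfolding q_def by (rule cInf_lower[OF _ bdd]) (use that in auto)
    have q_ge: "r \<le> q x" if "\<And>s. s \<in> A x \<Longrightarrow> r \<le> \<sigma> * s" for r x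
      unfolding q_def by (rule cInf_greatest) (use that A_ne in auto)
    have "\<exists>\<psi>. \<forall>x. (\<Sum>i<n. \<psi> i * x i) \<le> q x"
    proof (rule dominated_linear_functional)
      fix x y :: "nat \<Rightarrow> real"
      have "q (\<lambda>i. x i + y i) - \<sigma> * s \<le> q y" if "s \<in> A x" for s
      proof (rule q_ge)
        fix s' assume "s' \<in> A y"
        from q_le[OF A_add[OF that this]] show "q (\<lambda>i. x i + y i) - \<sigma> * s \<le> \<sigma> * s'"
          by (simp add: algebra_simps)
      qed
      then have "q (\<lambda>i. x i + y i) - q y \<le> q x"
        by (intro q_ge) (simp add: algebra_simps)
      then show "q (\<lambda>i. x i + y i) \<le> q x + q y" by simp
    next
      fix t :: real and x :: "nat \<Rightarrow> real" assume t: "t > 0"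
      have "q (\<lambda>i. t * x i) / t \<le> q x"
      proof (rule q_ge)
        fix s assume "s \<in> A x"
        from q_le[OF A_scale[OF this t]] t show "q (\<lambda>i. t * x i) / t \<le> \<sigma> * s"
          by (simp add: field_simps)
      qed
      then show "q (\<lambda>i. t * x i) \<le> t * q x" using t by (simp add: field_simps)
    next
      fix x y :: "nat \<Rightarrow> real" assume "\<And>i. i < n \<Longrightarrow> x i = y i"
      then have "A x = A y" by (auto simp: A_def)
      then show "q x = q y" by (simp add: q_def)
    qed
    then obtain \<psi> where \<psi>: "\<And>x. (\<Sum>i<n. \<psi> i * x i) \<le> q x" by blast
    define \<phi> where "\<phi> = (\<lambda>i. - \<psi> i)(n := \<sigma>)"
    have "0 \<le> (\<Sum>i<Suc n. \<phi> i * x i)" if "x \<in> C" for x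
    proof -
      have "x n \<in> A x" using that by (auto simp: A_def)
      with \<psi>[of x] q_le[of "x n" x] show ?thesis
        by (simp add: \<phi>_def sum_negf)
    qed
    moreover have "\<phi> n \<noteq> 0" using \<sigma>2 by (auto simp: \<phi>_def)
    ultimately show ?thesis by blast
  qed
qed

text \<open>
  A Stiemke-type alternative: the strictly positive combinations form a convex cone. If they miss
  some \<open>y\<close>, a functional that is nonnegative on the cone is nonnegative on each of the generating
  vectors, because their weights may be taken arbitrarily large.\<close>
lemma strictly_positive_combination:
  fixes u :: "nat \<Rightarrow> nat \<Rightarrow> real"
  assumes neg: "\<And>\<phi>. \<exists>c<d. \<phi> c \<noteq> 0 \<Longrightarrow> \<exists>i<l. (\<Sum>c<d. \<phi> c * u i c) < 0"
  shows "\<exists>w. (\<forall>i<l. w i > 0) \<and> (\<forall>c<d. (\<Sum>i<l. w i * u i c) = y c)"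
proof (rule ccontr)
  assume no: "\<not> ?thesis"
  define L where "L w = (\<lambda>c. \<Sum>i<l. w i * u i c)" for w :: "nat \<Rightarrow> real"
  define C where "C = L ` {w. \<forall>i<l. w i > 0}"
  have "\<exists>\<phi>. (\<exists>c<d. \<phi> c \<noteq> 0) \<and> (\<forall>x\<in>C. 0 \<le> (\<Sum>c<d. \<phi> c * x c))"
  proof (rule convex_cone_in_halfspace)
    fix x x' assume "x \<in> C" "x' \<in> C"
    then obtain w w' where "x = L w" "x' = L w'" "\<forall>i<l. w i > 0" "\<forall>i<l. w' i > 0"
      by (auto simp: C_def)
    then show "(\<lambda>c. x c + x' c) \<in> C"
      unfolding C_def
      by (intro image_eqI[where x = "\<lambda>i. w i + w' i"])
        (auto simp: L_def sum.distrib algebra_simps add_pos_pos)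
  next
    fix t :: real and x assume "t > 0" "x \<in> C"
    then obtain w where "x = L w" "\<forall>i<l. w i > 0" by (auto simp: C_def)
    with \<open>t > 0\<close> show "(\<lambda>c. t * x c) \<in> C"
      unfolding C_def
      by (intro image_eqI[where x = "\<lambda>i. t * w i"])
        (auto simp: L_def sum_distrib_left algebra_simps)
  next
    show "C \<noteq> {}" by (auto simp: C_def intro: exI[of _ "\<lambda>_. 1"])
  next
    fix x assume "x \<in> C"
    then show "\<exists>c<d. x c \<noteq> y c" using no by (auto simp: C_def L_def)
  qed
  then obtain \<phi> where \<phi>: "\<exists>c<d. \<phi> c \<noteq> 0" and pos: "\<And>x. x \<in> C \<Longrightarrow> 0 \<le> (\<Sum>c<d. \<phi> c * x c)"
    by blast
  from neg[OF \<phi>] obtain i where i: "i < l" "(\<Sum>c<d. \<phi> c * u i c) < 0" by blast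
  define f where "f j = (\<Sum>c<d. \<phi> c * u j c)" for j
  have L_f: "(\<Sum>c<d. \<phi> c * L w c) = (\<Sum>j<l. w j * f j)" for w
    unfolding L_def f_def sum_distrib_left
    by (subst sum.swap) (simp add: algebra_simps)
  \<comment> \<open>Weight \<open>\<tau>\<close> on the offending vector and \<open>1\<close> on the others: the value is affine in \<open>\<tau>\<close>
    with slope \<open>f i < 0\<close>, hence eventually negative.\<close>
  define K where "K = (\<Sum>j<l. f j)"
  define \<tau> where "\<tau> = (\<bar>K\<bar> + 1) / (- f i)"
  have fi: "f i < 0" using i by (simp add: f_def)
  have \<tau>: "\<tau> > 0" using fi unfolding \<tau>_def by (intro divide_pos_pos) auto
  have "L (\<lambda>j. if j = i then 1 + \<tau> else 1) \<in> C"
    using \<tau> by (auto simp: C_def)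
  from pos[OF this] have "0 \<le> (\<Sum>j<l. (if j = i then 1 + \<tau> else 1) * f j)"
    by (simp add: L_f)
  also have "\<dots> = (\<Sum>j<l. f j + (if j = i then \<tau> * f j else 0))"
    by (intro sum.cong) (auto simp: algebra_simps)
  also have "\<dots> = K + \<tau> * f i"
    using i(1) by (simp add: sum.distrib K_def)
  also have "\<tau> * f i = - (\<bar>K\<bar> + 1)"
    using fi by (simp add: \<tau>_def field_simps)
  finally show False by simp
qed

section \<open>Simultaneous Diophantine approximation\<close>

text \<open>
  Each new number only has to avoid the countably many values that are rationally dependent on the
  previous ones.\<close>
lemma integrally_independent_near:
  fixes \<mu>0 :: "nat \<Rightarrow> real"
  assumes "\<epsilon> > 0"
  shows "\<exists>\<mu>. (\<forall>i<l. \<mu>0 i < \<mu> i \<and> \<mu> i < \<mu>0 i + \<epsilon>) \<and>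
     (\<forall>c::nat \<Rightarrow> int. (\<Sum>i<l. of_int (c i) * \<mu> i) = 0 \<longrightarrow> (\<forall>i<l. c i = 0))"
proof (induction l)
  case 0
  then show ?case by simp
next
  case (Suc l)
  then obtain \<mu> where near: "\<And>i. i < l \<Longrightarrow> \<mu>0 i < \<mu> i \<and> \<mu> i < \<mu>0 i + \<epsilon>"
    and ind: "\<And>c::nat \<Rightarrow> int. (\<Sum>i<l. of_int (c i) * \<mu> i) = 0 \<Longrightarrow> (\<forall>i<l. c i = 0)" by blast
  define B where "B = range (\<lambda>(xs::int list, r::int). - (\<Sum>i<l. of_int (xs ! i) * \<mu> i) / of_int r)"
  have "countable B" unfolding B_def by simp
  then have "\<not> {\<mu>0 l <..< \<mu>0 l + \<epsilon>} \<subseteq> B"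
    using uncountable_open_interval[of "\<mu>0 l" "\<mu>0 l + \<epsilon>"] assms countable_subset by auto
  then obtain x where "x \<in> {\<mu>0 l <..< \<mu>0 l + \<epsilon>}" "x \<notin> B" by blast
  then have x: "\<mu>0 l < x" "x < \<mu>0 l + \<epsilon>" "x \<notin> B" by simp_all
  have "\<forall>i<Suc l. c i = 0" if "(\<Sum>i<Suc l. of_int (c i) * (\<mu>(l := x)) i) = 0" for c :: "nat \<Rightarrow> int"
  proof -
    have eq: "(\<Sum>i<l. of_int (c i) * \<mu> i) + of_int (c l) * x = 0" using that by simp
    have "c l = 0"
    proof (rule ccontr)
      assume "c l \<noteq> 0"
      have "(\<Sum>i<l. of_int (map c [0..<l] ! i) * \<mu> i) = (\<Sum>i<l. of_int (c i) * \<mu> i)"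
        by (intro sum.cong) auto
      with eq \<open>c l \<noteq> 0\<close> have "x = - (\<Sum>i<l. of_int (map c [0..<l] ! i) * \<mu> i) / of_int (c l)"
        by (simp add: field_simps)
      then have "x \<in> B" unfolding B_def by (intro image_eqI[where x = "(map c [0..<l], c l)"]) auto
      with x show False by simp
    qed
    with eq ind[of c] show ?thesis by (auto simp: less_Suc_eq)
  qed
  then show ?case
    using near x by (intro exI[of _ "\<mu>(l := x)"]) (auto simp: less_Suc_eq)
qed

text \<open>
  Kronecker's theorem gives a real time \<open>t\<close> of unknown sign and integers. A simultaneous Dirichlet
  approximation provides an arbitrarily large almost-period of \<open>t \<mapsto> (t * \<mu> i)\<^sub>i\<close> modulo 1, and adding it
  moves \<open>t\<close> beyond any bound, where positivity of the \<open>\<mu> i\<close> makes the integers natural numbers.\<close>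
lemma Kronecker_natural_multiples:
  fixes \<mu> y :: "nat \<Rightarrow> real"
  assumes ind: "\<And>c::nat \<Rightarrow> int. (\<Sum>i<l. of_int (c i) * \<mu> i) = 0 \<Longrightarrow> (\<forall>i<l. c i = 0)"
    and pos: "\<And>i. i < l \<Longrightarrow> \<mu> i > 0" and "\<epsilon> > 0"
  obtains t :: real and n :: "nat \<Rightarrow> nat"
  where "t \<ge> T" "\<And>i. i < l \<Longrightarrow> \<bar>real (n i) - (t * \<mu> i + y i)\<bar> < \<epsilon>"
proof -
  have inj: "inj_on \<mu> {..<l}"
  proof (rule inj_onI, rule ccontr)
    fix i j assume ij: "i \<in> {..<l}" "j \<in> {..<l}" "\<mu> i = \<mu> j" "i \<noteq> j"
    define c :: "nat \<Rightarrow> int" where "c k = (if k = i then 1 else 0) - (if k = j then 1 else 0)" for k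
    have "(\<Sum>k<l. of_int (c k) * \<mu> k) = (\<Sum>k<l. (if k = i then \<mu> k else 0) - (if k = j then \<mu> k else 0))"
      by (intro sum.cong) (auto simp: c_def)
    also have "\<dots> = 0" using ij by (simp add: sum_subtractf)
    finally have "c i = 0" using ind ij by blast
    then show False using ij by (simp add: c_def)
  qed
  interpret Z: Modules.module "\<lambda>r. (*) (real_of_int r)"
    by (simp add: Modules.module.intro distrib_left mult.commute)
  have "Z.independent (\<mu> ` {..<l})"
    unfolding Z.independent_explicit_module
  proof (intro allI impI)
    fix X u v assume X: "finite X" "X \<subseteq> \<mu> ` {..<l}" "(\<Sum>v\<in>X. real_of_int (u v) * v) = 0" "v \<in> X"
    have "(\<Sum>i<l. of_int (if \<mu> i \<in> X then u (\<mu> i) else 0) * \<mu> i)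
        = (\<Sum>x\<in>\<mu> ` {..<l}. of_int (if x \<in> X then u x else 0) * x)"
      by (simp add: sum.reindex[OF inj])
    also have "\<dots> = (\<Sum>x\<in>X. real_of_int (u x) * x)"
      by (rule sum.mono_neutral_cong_right) (use X in auto)
    finally have "\<forall>i<l. (if \<mu> i \<in> X then u (\<mu> i) else 0) = 0"
      using X(3) by (intro ind) simp
    moreover obtain i where "i < l" "v = \<mu> i" using X by blast
    ultimately show "u v = 0" using X(4) by force
  qed
  then obtain t0 h where h: "\<And>i. i < l \<Longrightarrow> \<bar>t0 * \<mu> i - of_int (h i) - (- y i)\<bar> < \<epsilon> / 2"
    using Kronecker_thm_1[OF _ inj, of "\<epsilon> / 2" "\<lambda>i. - y i"] \<open>\<epsilon> > 0\<close> by auto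
  define T' where "T' = \<bar>T\<bar> + (\<Sum>i<l. (\<bar>y i\<bar> + \<epsilon>) / \<mu> i)"
  have nonneg: "0 \<le> (\<bar>y i\<bar> + \<epsilon>) / \<mu> i" if "i < l" for i
    using pos[OF that] \<open>\<epsilon> > 0\<close> by simp
  obtain Q0 :: nat where "T' - t0 \<le> real Q0" using real_arch_simple by blast
  then obtain Q :: nat where Q: "Q > 0" "real Q \<ge> T' - t0"
    by (intro that[of "Suc Q0"]) auto
  obtain N :: nat where N: "N > 0" "1 / N < \<epsilon> / 2"
    using \<open>\<epsilon> > 0\<close> by (metis half_gt_zero gr_zeroI inverse_eq_divide real_arch_inverse)
  obtain q p where q: "0 < q" "\<And>i. i < l \<Longrightarrow> \<bar>of_int q * (real Q * \<mu> i) - of_int (p i)\<bar> < 1 / N"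
    using Dirichlet_approx_simult[OF N(1), of l "\<lambda>i. real Q * \<mu> i"] by metis
  define t where "t = t0 + of_int q * real Q"
  have t: "t \<ge> T'"
  proof -
    have "1 * real Q \<le> of_int q * real Q" using q by (intro mult_right_mono) auto
    then show ?thesis using Q unfolding t_def by linarith
  qed
  have *: "\<bar>of_int (h i + p i) - (t * \<mu> i + y i)\<bar> < \<epsilon>" if "i < l" for i
  proof -
    have "t * \<mu> i = t0 * \<mu> i + of_int q * (real Q * \<mu> i)"
      by (simp add: t_def algebra_simps)
    then show ?thesis
      using h[OF that] q(2)[OF that] N(2) unfolding of_int_add by linarith
  qed
  have "h i + p i \<ge> 0" if i: "i < l" for i
  proof -
    have "(\<bar>y i\<bar> + \<epsilon>) / \<mu> i \<le> (\<Sum>i<l. (\<bar>y i\<bar> + \<epsilon>) / \<mu> i)"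
      by (rule member_le_sum) (use i nonneg in auto)
    then have "(\<bar>y i\<bar> + \<epsilon>) / \<mu> i \<le> t" using t by (simp add: T'_def)
    then have "\<bar>y i\<bar> + \<epsilon> \<le> t * \<mu> i" using pos[OF i] by (simp add: field_simps)
    then have "of_int (h i + p i) > (0::real)" using *[OF i] by linarith
    then show ?thesis by linarith
  qed
  then have "\<bar>real (nat (h i + p i)) - (t * \<mu> i + y i)\<bar> < \<epsilon>" if "i < l" for i
    using *[OF that] that by simp
  moreover have "t \<ge> T"
    using t sum_nonneg[of "{..<l}" "\<lambda>i. (\<bar>y i\<bar> + \<epsilon>) / \<mu> i"] nonneg by (simp add: T'_def)
  ultimately show thesis using that[of t "\<lambda>i. nat (h i + p i)"] by blast
qed

section \<open>Maximal subsemigroups given by cocycles\<close>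

text \<open>
  The common source of the maximal subsemigroups that are used below: the nonnegativity domain of a
  continuous cocycle with positive multiplier. The set is closed under products by the cocycle
  identity. Once a larger semigroup \<open>N\<close> contains elements \<open>t\<close> with \<open>h t\<close> arbitrarily negative, every
  \<open>w\<close> is the product of such a \<open>t\<close> with \<open>t\<^sup>-\<^sup>1 w\<close>, where \<open>h\<close> is nonnegative.\<close>
lemma cocycle_halfspace_maximal:
  assumes "group G" and top: "topspace T = carrier G"
    and coc: "\<And>x y. x \<in> carrier G \<Longrightarrow> y \<in> carrier G \<Longrightarrow> h (x \<otimes>\<^bsub>G\<^esub> y) = h x + \<kappa> x * h y"
    and \<kappa>: "\<And>x. x \<in> carrier G \<Longrightarrow> \<kappa> x > 0"
    and cont: "continuous_map T euclideanreal h"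
    and x0: "x0 \<in> carrier G" "h x0 > 0"
    and unbounded: "\<And>N g r. subsemigroup G N \<Longrightarrow> {x \<in> carrier G. h x \<ge> 0} \<subseteq> N \<Longrightarrow>
      g \<in> N \<Longrightarrow> h g < 0 \<Longrightarrow> \<exists>t\<in>N. h t \<le> r"
  shows "maximal_subsemigroup G T {x \<in> carrier G. h x \<ge> 0}"
proof -
  interpret group G by fact
  let ?M = "{x \<in> carrier G. h x \<ge> 0}"
  have "h \<one>\<^bsub>G\<^esub> = 0"
    using coc[of "\<one>\<^bsub>G\<^esub>" "\<one>\<^bsub>G\<^esub>"] \<kappa>[of "\<one>\<^bsub>G\<^esub>"] by simp
  then have "h x0 + \<kappa> x0 * h (inv\<^bsub>G\<^esub> x0) = 0"
    using coc[of x0 "inv\<^bsub>G\<^esub> x0"] x0 by simp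
  moreover have "h x0 + \<kappa> x0 * h (inv\<^bsub>G\<^esub> x0) > 0" if "h (inv\<^bsub>G\<^esub> x0) \<ge> 0"
    using that x0 \<kappa>[of x0] by (simp add: add_pos_nonneg)
  ultimately have neg: "h (inv\<^bsub>G\<^esub> x0) < 0" by force
  have semi: "subsemigroup G ?M"
    using \<kappa> by (auto simp: subsemigroup_def coc less_imp_le)
  have "openin T {x \<in> topspace T. h x \<in> {0<..}}"
    using cont by (rule openin_continuous_map_preimage) simp
  then have "{x \<in> topspace T. h x \<in> {0<..}} \<subseteq> T interior_of ?M"
    by (intro interior_of_maximal) (auto simp: top)
  moreover have "x0 \<in> {x \<in> topspace T. h x \<in> {0<..}}" using x0 top by simp
  ultimately have int: "T interior_of ?M \<noteq> {}" by blast
  have "?M \<noteq> carrier G" using neg inv_closed[OF x0(1)]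
    by (metis (no_types, lifting) mem_Collect_eq not_le)
  moreover have "\<not> subgroup ?M G"
    using subgroup.m_inv_closed[of ?M G x0] x0 neg by force
  moreover have "N = carrier G \<or> N = ?M" if N: "subsemigroup G N" "?M \<subseteq> N" for N
  proof (rule disjCI)
    assume "N \<noteq> ?M"
    with N obtain g where g: "g \<in> N" "h g < 0"
      by (force simp: subsemigroup_def)
    have "w \<in> N" if w: "w \<in> carrier G" for w
    proof -
      obtain t where t: "t \<in> N" "h t \<le> h w" using unbounded[OF N g] by blast
      then have tG: "t \<in> carrier G" using N by (auto simp: subsemigroup_def)
      have w_eq: "t \<otimes>\<^bsub>G\<^esub> (inv\<^bsub>G\<^esub> t \<otimes>\<^bsub>G\<^esub> w) = w"
        using w tG by (simp add: m_assoc[symmetric])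
      have "h w = h t + \<kappa> t * h (inv\<^bsub>G\<^esub> t \<otimes>\<^bsub>G\<^esub> w)"
        using coc[of t "inv\<^bsub>G\<^esub> t \<otimes>\<^bsub>G\<^esub> w"] w tG by (simp add: w_eq)
      then have "h (inv\<^bsub>G\<^esub> t \<otimes>\<^bsub>G\<^esub> w) \<ge> 0"
        using t \<kappa>[OF tG] by (simp add: zero_le_mult_iff)
      then have "inv\<^bsub>G\<^esub> t \<otimes>\<^bsub>G\<^esub> w \<in> N" using N(2) w tG by auto
      then show ?thesis using N(1) t(1) w_eq unfolding subsemigroup_def by metis
    qed
    then show "N = carrier G" using N by (auto simp: subsemigroup_def)
  qed
  ultimately show ?thesis
    using semi int unfolding maximal_subsemigroup_def by blast
qed

lemma H_carrier_iff [simp]: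
  "(v, a, b) \<in> carrier (H_group m n) \<longleftrightarrow> (\<forall>i\<ge>m - 1. v i = 0) \<and> (\<forall>i\<ge>n. b i = 0)"
  by (simp add: H_group_def H_topology_def topspace_Euclidean_space)

lemma H_mult [simp]:
  "(v, a, b) \<otimes>\<^bsub>H_group m n\<^esub> (v', a', b')
     = (\<lambda>i. v i + v' i, a + a', \<lambda>i. b i + exp a * b' i)"
  by (simp add: H_group_def)

lemma H_topology_eq: "H_topology m n = top_of_set (carrier (H_group m n))"
  by (simp add: H_group_def H_topology_def Euclidean_space_def euclidean_product_topology
      prod_topology_subtopology subtopology_subtopology Times_Int_Times)

lemma tendsto_fun_iff:
  fixes f :: "'b \<Rightarrow> 'a \<Rightarrow> 'c::topological_space"
  shows "(f \<longlongrightarrow> l) F \<longleftrightarrow> (\<forall>i. ((\<lambda>x. f x i) \<longlongrightarrow> l i) F)"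
  using limitin_componentwise[of "\<lambda>_::'a. euclidean :: 'c topology" UNIV f l F]
  by (simp add: euclidean_product_topology)

lemma continuous_map_H_real:
  assumes "continuous_on UNIV h"
  shows "continuous_map (H_topology m n) euclideanreal h"
  unfolding H_topology_eq using assms continuous_on_subset by auto

lemma continuous_on_nth_fst: "continuous_on A (\<lambda>x. (fst x) (i::nat))"
  by (rule continuous_on_product_then_coordinatewise) (intro continuous_intros)

lemma continuous_on_nth_snd_snd: "continuous_on A (\<lambda>x. (snd (snd x)) (i::nat))"
  by (rule continuous_on_product_then_coordinatewise) (intro continuous_intros)

text \<open>
  Closed half-spaces of the abelianisation pull back to maximal subsemigroups: here the cocycle is
  a homomorphism to the reals, and powers of one element of negative value reach arbitrarily negative
  values.\<close>
lemma nonseparated_imp_negative_character: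
  assumes "nonseparated (H_group m n) (H_topology m n) S" and "S \<subseteq> carrier (H_group m n)"
    and nz: "(\<exists>i<m - 1. \<xi> i \<noteq> 0) \<or> c \<noteq> 0"
  shows "\<exists>(v, a, b)\<in>S. (\<Sum>i<m - 1. \<xi> i * v i) + c * a < 0"
proof -
  define h :: "(nat \<Rightarrow> real) \<times> real \<times> (nat \<Rightarrow> real) \<Rightarrow> real"
    where "h x = (\<Sum>i<m - 1. \<xi> i * fst x i) + c * fst (snd x)" for x
  have "maximal_subsemigroup (H_group m n) (H_topology m n) {x \<in> carrier (H_group m n). h x \<ge> 0}"
  proof (rule cocycle_halfspace_maximal[OF group_H_group topspace_H_topology, where \<kappa> = "\<lambda>_. 1"])
    show "h (x \<otimes>\<^bsub>H_group m n\<^esub> y) = h x + 1 * h y" for x y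
      by (cases x; cases y) (simp add: h_def sum.distrib algebra_simps)
    show "continuous_map (H_topology m n) euclideanreal h"
      unfolding h_def
      by (intro continuous_map_H_real continuous_intros continuous_on_nth_fst)
    show "(\<lambda>i. if i < m - 1 then \<xi> i else 0, c, \<lambda>_. 0) \<in> carrier (H_group m n)" by simp
    have "(\<Sum>i<m - 1. \<xi> i * \<xi> i) + c * c > 0"
      using nz
    proof
      assume "\<exists>i<m - 1. \<xi> i \<noteq> 0"
      then have "(\<Sum>i<m - 1. \<xi> i * \<xi> i) > 0"
        by (auto intro!: sum_pos2 simp: zero_less_mult_iff linorder_neq_iff)
      then show ?thesis by (simp add: add_pos_nonneg)
    next
      assume "c \<noteq> 0"
      then show ?thesis
        by (intro add_nonneg_pos sum_nonneg) (auto simp: zero_less_mult_iff linorder_neq_iff)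
    qed
    then show "h (\<lambda>i. if i < m - 1 then \<xi> i else 0, c, \<lambda>_. 0) > 0"
      by (simp add: h_def)
  next
    fix N g r assume N: "subsemigroup (H_group m n) N" and g: "g \<in> N" "h g < 0"
    have "\<exists>t\<in>N. h t = (1 + real k) * h g" for k
    proof (induction k)
      case 0
      then show ?case using g by auto
    next
      case (Suc k)
      then obtain t where "t \<in> N" "h t = (1 + real k) * h g" by blast
      moreover have "h (t \<otimes>\<^bsub>H_group m n\<^esub> g) = h t + h g"
        by (cases t; cases g) (simp add: h_def sum.distrib algebra_simps)
      ultimately show ?case
        using N g unfolding subsemigroup_def
        by (intro bexI[of _ "t \<otimes>\<^bsub>H_group m n\<^esub> g"]) (auto simp: algebra_simps)
    qed
    moreover obtain k :: nat where "r / h g \<le> real k" using real_arch_simple by blast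
    then have "(1 + real k) * h g \<le> r" using g(2) by (simp add: field_simps)
    ultimately show "\<exists>t\<in>N. h t \<le> r" by metis
  qed simp
  then obtain x where "x \<in> S" "h x < 0"
    using assms by (force simp: nonseparated_def)
  then show ?thesis
    by (intro bexI[of _ x]) (simp_all add: h_def case_prod_beta)
qed

text \<open>
  Viewed as the affine map \<open>x \<mapsto> b + exp a * x\<close>, the element \<open>(v, a, b)\<close> maps the half-space
  \<open>{x. \<phi> x \<ge> c}\<close> into itself iff \<open>\<phi> b + c * (exp a - 1) \<ge> 0\<close>. The left-hand side is a cocycle with
  multiplier \<open>exp a\<close>. Multiplying an element of negative value on the left by an element
  of value \<open>0\<close>, a dilation about a boundary point of the half-space with large factor, makes the value
  arbitrarily negative.\<close>
lemma nonseparated_imp_halfspace_moved: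
  assumes "nonseparated (H_group m n) (H_topology m n) S" and "S \<subseteq> carrier (H_group m n)"
    and nz: "\<exists>i<n. \<phi> i \<noteq> 0"
  shows "\<exists>(v, a, b)\<in>S. (\<Sum>i<n. \<phi> i * b i) + c * (exp a - 1) < 0"
proof -
  define h :: "(nat \<Rightarrow> real) \<times> real \<times> (nat \<Rightarrow> real) \<Rightarrow> real"
    where "h x = (\<Sum>i<n. \<phi> i * snd (snd x) i) + c * (exp (fst (snd x)) - 1)" for x
  have coc: "h (x \<otimes>\<^bsub>H_group m n\<^esub> y) = h x + exp (fst (snd x)) * h y" for x y
    by (cases x; cases y) (simp add: h_def sum.distrib sum_distrib_left algebra_simps exp_add)
  have pos: "(\<Sum>i<n. \<phi> i * \<phi> i) > 0"
    using nz by (auto intro!: sum_pos2 simp: zero_less_mult_iff linorder_neq_iff)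
  have "maximal_subsemigroup (H_group m n) (H_topology m n) {x \<in> carrier (H_group m n). h x \<ge> 0}"
  proof (rule cocycle_halfspace_maximal[OF group_H_group topspace_H_topology coc])
    show "continuous_map (H_topology m n) euclideanreal h"
      unfolding h_def
      by (intro continuous_map_H_real continuous_intros continuous_on_nth_snd_snd)
    show "(\<lambda>_. 0, 0, \<lambda>i. if i < n then \<phi> i else 0) \<in> carrier (H_group m n)" by simp
    show "h (\<lambda>_. 0, 0, \<lambda>i. if i < n then \<phi> i else 0) > 0"
      using pos by (simp add: h_def)
  next
    fix N g r assume N: "subsemigroup (H_group m n) N" "{x \<in> carrier (H_group m n). h x \<ge> 0} \<subseteq> N"
      and g: "g \<in> N" "h g < 0"
    \<comment> \<open>\<open>s\<close> is a sufficient logarithmic dilation factor; the multiple \<open>k\<close> of \<open>\<phi>\<close> as translation part gives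
      \<open>t\<close> the value \<open>0\<close>.\<close>
    define s where "s = ln (max 1 (r / h g))"
    define k where "k = c * (1 - exp s) / (\<Sum>i<n. \<phi> i * \<phi> i)"
    define t :: "(nat \<Rightarrow> real) \<times> real \<times> (nat \<Rightarrow> real)"
      where "t = (\<lambda>_. 0, s, \<lambda>i. if i < n then k * \<phi> i else 0)"
    have "(\<Sum>i<n. \<phi> i * (k * \<phi> i)) = k * (\<Sum>i<n. \<phi> i * \<phi> i)"
      by (simp add: sum_distrib_left algebra_simps)
    also have "\<dots> = c * (1 - exp s)" using pos by (simp add: k_def)
    finally have ht: "h t = 0" by (simp add: h_def t_def algebra_simps)
    then have "t \<in> N" using N by (auto simp: t_def)
    then have "t \<otimes>\<^bsub>H_group m n\<^esub> g \<in> N" using N g by (auto simp: subsemigroup_def)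
    moreover have "h (t \<otimes>\<^bsub>H_group m n\<^esub> g) \<le> r"
    proof -
      have "exp s \<ge> r / h g" by (simp add: s_def)
      then have "exp s * h g \<le> r" using g(2) by (simp add: field_simps)
      then show ?thesis by (simp add: coc ht) (simp add: t_def)
    qed
    ultimately show "\<exists>t\<in>N. h t \<le> r" by blast
  qed simp
  then obtain x where "x \<in> S" "h x < 0"
    using assms by (force simp: nonseparated_def)
  then show ?thesis
    by (intro bexI[of _ x]) (simp_all add: h_def case_prod_beta)
qed

text \<open>
  A dense subsemigroup \<open>M\<close> with an interior point is the whole group: for every \<open>g\<close> the \<open>s\<close> for which
  \<open>s\<^sup>-\<^sup>1 g\<close> is interior to \<open>M\<close> form a nonempty open set, hence one of them lies in \<open>M\<close>, and then so
  does \<open>g = s (s\<^sup>-\<^sup>1 g)\<close>.\<close>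
lemma multiplicatively_dense_imp_nonseparated:
  assumes S: "S \<subseteq> carrier (H_group m n)"
    and dense: "multiplicatively_dense (H_group m n) (H_topology m n) S"
  shows "nonseparated (H_group m n) (H_topology m n) S"
proof -
  let ?G = "H_group m n" and ?T = "H_topology m n"
  interpret group ?G by (rule group_H_group)
  have "M = carrier ?G" if M: "subsemigroup ?G M" "?T interior_of M \<noteq> {}" "S \<subseteq> M" for M
  proof -
    have "subsemigroup ?G hull S \<subseteq> M" by (rule hull_minimal) (use M in auto)
    then have M_dense: "?T closure_of M = carrier ?G"
      using dense closure_of_mono[of "subsemigroup ?G hull S" M ?T] closure_of_subset_topspace[of ?T M]
      unfolding multiplicatively_dense_def topspace_H_topology by blast
    obtain u0 where u0: "u0 \<in> ?T interior_of M" using M by blast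
    have "g \<in> M" if g: "g \<in> carrier ?G" for g
    proof -
      obtain v a b where g_eq: "g = (v, a, b)" by (cases g) auto
      define f :: "(nat \<Rightarrow> real) \<times> real \<times> (nat \<Rightarrow> real) \<Rightarrow> (nat \<Rightarrow> real) \<times> real \<times> (nat \<Rightarrow> real)"
        where "f s = (\<lambda>i. v i - fst s i, a - fst (snd s),
          \<lambda>i. exp (- fst (snd s)) * (b i - snd (snd s) i))" for s
      have mult_f: "s \<otimes>\<^bsub>?G\<^esub> f s = g" for s
        by (cases s) (auto simp: f_def g_eq exp_minus field_simps)
      have f_in: "f s \<in> carrier ?G" if "s \<in> carrier ?G" for s
        using that g by (cases s) (simp add: f_def g_eq)
      have "continuous_on UNIV f"
        unfolding f_def
        by (intro continuous_intros continuous_on_coordinatewise_then_product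
            continuous_on_nth_fst continuous_on_nth_snd_snd)
      then have "continuous_map ?T ?T f"
        using f_in unfolding H_topology_eq
        by (auto intro: continuous_on_subset)
      then have op: "openin ?T {s \<in> topspace ?T. f s \<in> ?T interior_of M}"
        by (rule openin_continuous_map_preimage) simp
      have u0G: "u0 \<in> carrier ?G"
        using u0 interior_of_subset_topspace[of ?T M] by (auto simp: topspace_H_topology)
      define s0 where "s0 = g \<otimes>\<^bsub>?G\<^esub> inv\<^bsub>?G\<^esub> u0"
      have s0: "s0 \<in> carrier ?G" using g u0G by (simp add: s0_def)
      have "s0 \<otimes>\<^bsub>?G\<^esub> u0 = g" using g u0G by (simp add: s0_def m_assoc)
      then have "f s0 = u0" using Units_l_cancel[of s0 "f s0" u0] mult_f[of s0] s0 u0G f_in[OF s0] by simp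
      then have s0_U: "s0 \<in> {s \<in> topspace ?T. f s \<in> ?T interior_of M}"
        using s0 u0 by (simp add: topspace_H_topology)
      have "s0 \<in> H_topology m n closure_of M" using M_dense s0 by simp
      then have "\<exists>s. s \<in> M \<and> s \<in> {s \<in> topspace ?T. f s \<in> ?T interior_of M}"
        by (rule in_closure_of[THEN iffD1, THEN conjunct2, rule_format]) (intro conjI s0_U op)
      then obtain s where "s \<in> M" "f s \<in> ?T interior_of M" by blast
      then have s: "s \<in> M" "f s \<in> M" using interior_of_subset[of ?T M] by auto
      then have "s \<otimes>\<^bsub>?G\<^esub> f s \<in> M" using M(1) s unfolding subsemigroup_def by blast
      then show ?thesis by (simp only: mult_f)
    qed
    then show ?thesis using M by (auto simp: subsemigroup_def)
  qed
  then show ?thesis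
    unfolding nonseparated_def maximal_subsemigroup_def by blast
qed

section \<open>Limits of words in a closed subsemigroup\<close>

lemma subsemigroup_closure_of:
  assumes S: "subsemigroup (H_group m n) S"
  shows "subsemigroup (H_group m n) (H_topology m n closure_of S)"
proof -
  let ?C = "carrier (H_group m n)"
  have SC: "S \<subseteq> ?C" using S by (simp add: subsemigroup_def)
  have eq: "H_topology m n closure_of S = ?C \<inter> closure S"
    using SC by (simp add: H_topology_eq closure_of_subtopology inf.absorb2)
  have "x \<otimes>\<^bsub>H_group m n\<^esub> y \<in> ?C \<inter> closure S" if x: "x \<in> ?C \<inter> closure S" and y: "y \<in> ?C \<inter> closure S" for x y
  proof
    interpret group "H_group m n" by (rule group_H_group)
    show "x \<otimes>\<^bsub>H_group m n\<^esub> y \<in> ?C" using x y by simp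
    obtain f where f: "\<And>j. f j \<in> S" "f \<longlonglongrightarrow> x" using x closure_sequential[of x S] by auto
    obtain g where g: "\<And>j. g j \<in> S" "g \<longlonglongrightarrow> y" using y closure_sequential[of y S] by auto
    have mult: "s \<otimes>\<^bsub>H_group m n\<^esub> t = (\<lambda>i. fst s i + fst t i, fst (snd s) + fst (snd t),
        \<lambda>i. snd (snd s) i + exp (fst (snd s)) * snd (snd t) i)" for s t
      by (cases s; cases t) simp
    have coord: "(\<lambda>j. fst (f j) i) \<longlonglongrightarrow> fst x i" "(\<lambda>j. fst (g j) i) \<longlonglongrightarrow> fst y i"
        "(\<lambda>j. snd (snd (f j)) i) \<longlonglongrightarrow> snd (snd x) i" "(\<lambda>j. snd (snd (g j)) i) \<longlonglongrightarrow> snd (snd y) i" for i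
      using tendsto_fst[OF f(2)] tendsto_fst[OF g(2)] tendsto_snd[OF tendsto_snd[OF f(2)]]
        tendsto_snd[OF tendsto_snd[OF g(2)]] unfolding tendsto_fun_iff by blast+
    have "(\<lambda>j. f j \<otimes>\<^bsub>H_group m n\<^esub> g j) \<longlonglongrightarrow> x \<otimes>\<^bsub>H_group m n\<^esub> y"
      unfolding mult
      by (intro tendsto_Pair tendsto_fun_iff[THEN iffD2] allI tendsto_intros coord f(2) g(2))
    moreover have "\<forall>j. f j \<otimes>\<^bsub>H_group m n\<^esub> g j \<in> S"
      using f g S by (auto simp: subsemigroup_def)
    ultimately show "x \<otimes>\<^bsub>H_group m n\<^esub> y \<in> closure S"
      by (intro closure_sequential[THEN iffD2] exI conjI)
  qed
  then show ?thesis by (auto simp: subsemigroup_def eq)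
qed

text \<open>
  \<open>tame_over Q B L v a\<close>: some product of elements of \<open>Q\<close>, possibly the empty product, has the
  components \<open>v\<close> and \<open>a\<close>, and its translation part is at most what \<open>L\<close> letters with translation parts
  bounded by \<open>B\<close> produce when no partial product dilates by more than \<open>max 1 (exp a)\<close>.\<close>
definition tame_over ::
    "((nat \<Rightarrow> real) \<times> real \<times> (nat \<Rightarrow> real)) set \<Rightarrow> real \<Rightarrow> real \<Rightarrow> (nat \<Rightarrow> real) \<Rightarrow> real \<Rightarrow> bool"
  where "tame_over Q B L v a \<longleftrightarrow>
    (\<exists>b. (v, a, b) \<in> insert (\<lambda>_. 0, 0, \<lambda>_. 0) Q \<and> (\<forall>c. \<bar>b c\<bar> \<le> L * B * max 1 (exp a)))"

text \<open>
  Concatenation keeps the bound as long as contractions precede expansions: the partial sums of the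
  logarithmic dilation factors then never exceed the larger of \<open>0\<close> and the total.\<close>
lemma tame_over_mult:
  assumes Q: "subsemigroup (H_group m n) Q" and "B \<ge> 0" "L \<ge> 0" "L' \<ge> 0"
    and t: "tame_over Q B L v a" and t': "tame_over Q B L' v' a'"
    and sgn: "a \<le> 0 \<or> a' \<ge> 0"
  shows "tame_over Q B (L + L') (\<lambda>c. v c + v' c) (a + a')"
proof -
  obtain b where b: "(v, a, b) \<in> insert (\<lambda>_. 0, 0, \<lambda>_. 0) Q" "\<And>c. \<bar>b c\<bar> \<le> L * B * max 1 (exp a)"
    using t by (auto simp: tame_over_def)
  obtain b' where b': "(v', a', b') \<in> insert (\<lambda>_. 0, 0, \<lambda>_. 0) Q" "\<And>c. \<bar>b' c\<bar> \<le> L' * B * max 1 (exp a')"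
    using t' by (auto simp: tame_over_def)
  have "(v, a, b) \<otimes>\<^bsub>H_group m n\<^esub> (v', a', b') \<in> insert (\<lambda>_. 0, 0, \<lambda>_. 0) Q"
  proof (cases "(v, a, b) \<in> Q \<and> (v', a', b') \<in> Q")
    case True
    then show ?thesis using Q by (auto simp only: subsemigroup_def)
  next
    case False
    then show ?thesis using b(1) b'(1) by auto
  qed
  then have "(\<lambda>c. v c + v' c, a + a', \<lambda>c. b c + exp a * b' c) \<in> insert (\<lambda>_. 0, 0, \<lambda>_. 0) Q"
    by simp
  moreover have "\<bar>b c + exp a * b' c\<bar> \<le> (L + L') * B * max 1 (exp (a + a'))" for c
  proof -
    have 1: "max 1 (exp a) \<le> max 1 (exp (a + a'))" using sgn by (auto simp: max_def)
    have 2: "exp a * max 1 (exp a') \<le> max 1 (exp (a + a'))"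
    proof (cases "a' \<ge> 0")
      case True
      then show ?thesis by (simp add: max_absorb2 exp_add)
    next
      case False
      then have "max 1 (exp a') = 1" "exp a \<le> 1 \<or> exp a \<le> exp (a + a')" using sgn by auto
      then show ?thesis by (simp add: le_max_iff_disj)
    qed
    have "\<bar>b c + exp a * b' c\<bar> \<le> \<bar>b c\<bar> + exp a * \<bar>b' c\<bar>"
      by (rule order_trans[OF abs_triangle_ineq]) (simp add: abs_mult)
    also have "\<dots> \<le> L * B * max 1 (exp a) + exp a * (L' * B * max 1 (exp a'))"
      by (intro add_mono mult_left_mono b b') simp
    also have "\<dots> = L * B * max 1 (exp a) + L' * B * (exp a * max 1 (exp a'))" by simp
    also have "\<dots> \<le> L * B * max 1 (exp (a + a')) + L' * B * max 1 (exp (a + a'))"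
      using assms by (intro add_mono mult_left_mono 1 2) auto
    finally show ?thesis by (simp add: algebra_simps)
  qed
  ultimately show ?thesis unfolding tame_over_def by blast
qed

lemma tame_over_one: "tame_over Q B 0 (\<lambda>_. 0) 0"
  unfolding tame_over_def by (intro exI[of _ "\<lambda>_. 0"]) simp

lemma tame_over_power:
  assumes "subsemigroup (H_group m n) Q" "B \<ge> 0" "tame_over Q B 1 v a"
  shows "tame_over Q B (real k) (\<lambda>c. real k * v c) (real k * a)"
proof (induction k)
  case 0
  then show ?case using tame_over_one by simp
next
  case (Suc k)
  have "a \<le> 0 \<or> real k * a \<ge> 0" by (simp add: zero_le_mult_iff) linarith
  from tame_over_mult[OF assms(1,2) _ _ assms(3) Suc this]
  show ?case by (simp add: algebra_simps)
qed

lemma tame_over_same_sign: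
  assumes Q: "subsemigroup (H_group m n) Q" "B \<ge> 0" and "finite I"
    and "\<And>i. i \<in> I \<Longrightarrow> tame_over Q B 1 (v i) (a i)"
    and "(\<forall>i\<in>I. a i \<le> 0) \<or> (\<forall>i\<in>I. a i \<ge> 0)"
  shows "tame_over Q B (\<Sum>i\<in>I. real (N i)) (\<lambda>c. \<Sum>i\<in>I. real (N i) * v i c) (\<Sum>i\<in>I. real (N i) * a i)"
  using assms(3-)
proof (induction I rule: finite_induct)
  case empty
  then show ?case using tame_over_one by simp
next
  case (insert i I)
  have "real (N i) * a i \<le> 0 \<or> (\<Sum>i\<in>I. real (N i) * a i) \<ge> 0"
    using insert.prems(2) by (auto intro!: sum_nonneg simp: mult_nonneg_nonpos)
  from tame_over_mult[OF Q _ _ tame_over_power[OF Q insert.prems(1), of i "N i"] insert.IH this]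
  show ?case using insert by (auto simp: sum_nonneg)
qed

text \<open>
  All letters with nonpositive \<open>a\<close> are placed first.\<close>
lemma tame_over_multi_power:
  assumes Q: "subsemigroup (H_group m n) Q" "B \<ge> 0" and I: "finite I"
    and t: "\<And>i. i \<in> I \<Longrightarrow> tame_over Q B 1 (v i) (a i)"
  shows "tame_over Q B (\<Sum>i\<in>I. real (N i)) (\<lambda>c. \<Sum>i\<in>I. real (N i) * v i c) (\<Sum>i\<in>I. real (N i) * a i)"
proof -
  define I1 I2 where "I1 = {i \<in> I. a i \<le> 0}" and "I2 = {i \<in> I. a i > 0}"
  have fin: "finite I1" "finite I2" and dis: "I1 \<inter> I2 = {}" and un: "I = I1 \<union> I2"
    using I by (auto simp: I1_def I2_def)
  have "tame_over Q B ((\<Sum>i\<in>I1. real (N i)) + (\<Sum>i\<in>I2. real (N i)))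
     (\<lambda>c. (\<Sum>i\<in>I1. real (N i) * v i c) + (\<Sum>i\<in>I2. real (N i) * v i c))
     ((\<Sum>i\<in>I1. real (N i) * a i) + (\<Sum>i\<in>I2. real (N i) * a i))"
  proof (rule tame_over_mult[OF Q])
    show "tame_over Q B (\<Sum>i\<in>I1. real (N i)) (\<lambda>c. \<Sum>i\<in>I1. real (N i) * v i c) (\<Sum>i\<in>I1. real (N i) * a i)"
      by (rule tame_over_same_sign[OF Q fin(1)]) (auto intro: t simp: I1_def)
    show "tame_over Q B (\<Sum>i\<in>I2. real (N i)) (\<lambda>c. \<Sum>i\<in>I2. real (N i) * v i c) (\<Sum>i\<in>I2. real (N i) * a i)"
      by (rule tame_over_same_sign[OF Q fin(2)]) (auto intro: t simp: I2_def)
    show "(\<Sum>i\<in>I1. real (N i) * a i) \<le> 0 \<or> (\<Sum>i\<in>I2. real (N i) * a i) \<ge> 0"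
      by (auto intro!: sum_nonneg simp: I2_def)
  qed (auto intro: sum_nonneg)
  then show ?thesis
    using fin dis by (simp add: un sum.union_disjoint)
qed

text \<open>
  A homothety with \<open>a \<noteq> 0\<close> has the fixed point \<open>x = b / (1 - exp a)\<close>, and its powers are the
  homotheties about \<open>x\<close>.\<close>
lemma power_of_homothety:
  assumes Q: "subsemigroup (H_group m n) Q" and g: "(v, a, b) \<in> Q" and "a \<noteq> 0" "k \<ge> 1"
  defines "x \<equiv> \<lambda>c. b c / (1 - exp a)"
  shows "(\<lambda>c. real k * v c, real k * a, \<lambda>c. (1 - exp (real k * a)) * x c) \<in> Q"
  using \<open>k \<ge> 1\<close>
proof (induction k rule: dec_induct)
  case base
  have "(\<lambda>c. (1 - exp a) * x c) = b" using \<open>a \<noteq> 0\<close> by (simp add: x_def)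
  then show ?case using g by simp
next
  case (step k)
  from step.IH g have "(v, a, b) \<otimes>\<^bsub>H_group m n\<^esub>
      (\<lambda>c. real k * v c, real k * a, \<lambda>c. (1 - exp (real k * a)) * x c) \<in> Q"
    using Q by (auto simp only: subsemigroup_def)
  also have "(v, a, b) \<otimes>\<^bsub>H_group m n\<^esub> (\<lambda>c. real k * v c, real k * a, \<lambda>c. (1 - exp (real k * a)) * x c)
     = (\<lambda>c. real (Suc k) * v c, real (Suc k) * a, \<lambda>c. (1 - exp (real (Suc k) * a)) * x c)"
  proof -
    have "b c = (1 - exp a) * x c" for c using \<open>a \<noteq> 0\<close> by (simp add: x_def)
    then show ?thesis by (simp add: algebra_simps exp_add)
  qed
  finally show ?case .
qed

text \<open>
  For large \<open>t\<close>, take about \<open>t * \<mu> i + y i\<close> copies of the letter \<open>i\<close>. As the weights \<open>\<mu>\<close> balance the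
  letters, the component of the product in the abelianisation tends to the combination with
  coefficients \<open>y\<close>. Arrange the letters so that all copies of the contraction \<open>i0\<close> come first, all
  copies of the expansion \<open>i1\<close> last, and the others in between in tame order. The outer powers push
  the dilation factor of the middle part down exponentially in \<open>t\<close>, whereas its length grows only
  linearly, so that its translation part disappears in the limit. What remains are the fixed points
  \<open>x0\<close> and \<open>x1\<close> of the two outer letters: the limit is the map \<open>z \<mapsto> x0 + exp A * (z - x1)\<close>, where
  \<open>A\<close> is the limit of the logarithmic dilation factors.\<close>
lemma limit_of_words:
  fixes v b :: "nat \<Rightarrow> nat \<Rightarrow> real" and a \<mu> y :: "nat \<Rightarrow> real"
  assumes Q: "subsemigroup (H_group m n) Q" "closedin (H_topology m n) Q"
    and p: "\<And>i. i < l \<Longrightarrow> (v i, a i, b i) \<in> Q"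
    and ind: "\<And>c::nat \<Rightarrow> int. (\<Sum>i<l. of_int (c i) * \<mu> i) = 0 \<Longrightarrow> (\<forall>i<l. c i = 0)"
    and pos: "\<And>i. i < l \<Longrightarrow> \<mu> i > 0"
    and bal_v: "\<And>c. (\<Sum>i<l. \<mu> i * v i c) = 0" and bal_a: "(\<Sum>i<l. \<mu> i * a i) = 0"
    and i0: "i0 < l" "a i0 < 0" and i1: "i1 < l" "a i1 > 0"
  shows "(\<lambda>c. \<Sum>i<l. y i * v i c, \<Sum>i<l. y i * a i,
     \<lambda>c. b i0 c / (1 - exp (a i0)) - exp (\<Sum>i<l. y i * a i) * (b i1 c / (1 - exp (a i1)))) \<in> Q"
proof -
  have QC: "Q \<subseteq> carrier (H_group m n)" using Q(1) by (simp add: subsemigroup_def)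
  define x0 x1 where "x0 = (\<lambda>c. b i0 c / (1 - exp (a i0)))" and "x1 = (\<lambda>c. b i1 c / (1 - exp (a i1)))"
  define V A where "V = (\<lambda>c. \<Sum>i<l. y i * v i c)" and "A = (\<Sum>i<l. y i * a i)"
  define Y where "Y = (\<Sum>i<l. \<bar>y i\<bar>) + 1"
  have Y: "\<bar>y i\<bar> + 1 \<le> Y" if "i < l" for i
    unfolding Y_def using that by (intro add_mono member_le_sum) auto
  \<comment> \<open>The second lower bound for \<open>t\<close> forces at least one copy of the letter \<open>i0\<close>, so that the words
    below are nonempty and their products lie in \<open>Q\<close> itself.\<close>
  have "\<exists>t N. t \<ge> real j \<and> t \<ge> (Y + 1) / \<mu> i0 \<and> (\<forall>i<l. \<bar>real (N i) - (t * \<mu> i + y i)\<bar> < 1 / (real j + 1))" for j :: nat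
  proof -
    have "(0::real) < 1 / (real j + 1)" by simp
    from Kronecker_natural_multiples[where l = l and \<mu> = \<mu> and y = y
        and T = "max (real j) ((Y + 1) / \<mu> i0)", OF ind pos this]
    obtain t N where "max (real j) ((Y + 1) / \<mu> i0) \<le> t"
      "\<And>i. i < l \<Longrightarrow> \<bar>real (N i) - (t * \<mu> i + y i)\<bar> < 1 / (real j + 1)" by blast
    then show ?thesis by auto
  qed
  then obtain t N where t: "\<And>j. t j \<ge> real j" and t2: "\<And>j. t j \<ge> (Y + 1) / \<mu> i0"
    and N: "\<And>j i. i < l \<Longrightarrow> \<bar>real (N j i) - (t j * \<mu> i + y i)\<bar> < 1 / (real j + 1)"
    by metis
  have t_top: "filterlim t at_top sequentially"
    by (rule filterlim_at_top_mono[OF filterlim_real_sequentially]) (simp add: t)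
  have N1: "\<bar>real (N j i) - t j * \<mu> i\<bar> \<le> Y" if i: "i < l" for i j
  proof -
    have "1 / (real j + 1) \<le> (1::real)" by simp
    then show ?thesis using N[OF i, of j] Y[OF i] by linarith
  qed
  have N_i0: "N j i0 \<ge> 1" for j
  proof -
    have "Y + 1 \<le> t j * \<mu> i0" using t2[of j] pos[OF i0(1)] by (simp add: field_simps)
    then have "real (N j i0) > 0" using N1[OF i0(1), of j] by linarith
    then show ?thesis by linarith
  qed
  have lim_sum: "(\<lambda>j. \<Sum>i<l. real (N j i) * r i) \<longlonglongrightarrow> (\<Sum>i<l. y i * r i)"
    if r: "(\<Sum>i<l. \<mu> i * r i) = 0" for r
  proof -
    have "(\<lambda>j. real (N j i) - (t j * \<mu> i + y i)) \<longlonglongrightarrow> 0" if "i < l" for i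
    proof (rule Lim_null_comparison)
      show "(\<lambda>j. 1 / (real j + 1)) \<longlonglongrightarrow> 0" by real_asymp
      show "\<forall>\<^sub>F j in sequentially. norm (real (N j i) - (t j * \<mu> i + y i)) \<le> 1 / (real j + 1)"
        using N[OF that] by (intro always_eventually allI) (simp add: less_imp_le)
    qed
    then have "(\<lambda>j. \<Sum>i<l. (real (N j i) - (t j * \<mu> i + y i)) * r i) \<longlonglongrightarrow> 0"
      by (intro tendsto_null_sum tendsto_mult_left_zero) auto
    moreover have "(\<Sum>i<l. (real (N j i) - (t j * \<mu> i + y i)) * r i)
        = (\<Sum>i<l. real (N j i) * r i) - (\<Sum>i<l. y i * r i)" for j
    proof -
      have "(\<Sum>i<l. (real (N j i) - (t j * \<mu> i + y i)) * r i)
        = (\<Sum>i<l. real (N j i) * r i - t j * (\<mu> i * r i) - y i * r i)"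
        by (intro sum.cong) (auto simp: algebra_simps)
      also have "\<dots> = (\<Sum>i<l. real (N j i) * r i) - t j * (\<Sum>i<l. \<mu> i * r i) - (\<Sum>i<l. y i * r i)"
        by (simp add: sum_subtractf sum_distrib_left)
      finally show ?thesis using r by simp
    qed
    ultimately show ?thesis by (simp add: LIM_zero_iff)
  qed
  have decay: "(\<lambda>j. (t j * M + K) * exp (- (real (N j i) * r))) \<longlonglongrightarrow> 0"
    if i: "i < l" and r: "r > 0" and MK: "M \<ge> 0" "K \<ge> 0" for M K i r
  proof (rule Lim_null_comparison)
    define k where "k = \<mu> i * r"
    have k: "k > 0" using pos[OF i] r by (simp add: k_def)
    have "((\<lambda>s. (s * M + K) * exp (- (k * s)) * exp (Y * r)) \<longlongrightarrow> 0) at_top"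
      using k by real_asymp
    from filterlim_compose[OF this t_top]
    show "(\<lambda>j. (t j * M + K) * exp (- (k * t j)) * exp (Y * r)) \<longlonglongrightarrow> 0" .
    show "\<forall>\<^sub>F j in sequentially. norm ((t j * M + K) * exp (- (real (N j i) * r)))
        \<le> (t j * M + K) * exp (- (k * t j)) * exp (Y * r)"
    proof (intro always_eventually allI)
      fix j
      have tj: "t j \<ge> 0" using t[of j] by linarith
      have "(t j * \<mu> i - Y) * r \<le> real (N j i) * r"
        using N1[OF i, of j] r by (intro mult_right_mono) linarith+
      then have "exp (- (real (N j i) * r)) \<le> exp (- (k * t j) + Y * r)"
        by (simp add: k_def algebra_simps)
      then have "(t j * M + K) * exp (- (real (N j i) * r)) \<le> (t j * M + K) * (exp (- (k * t j)) * exp (Y * r))"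
        using tj MK by (intro mult_left_mono) (auto simp: exp_add[symmetric])
      then show "norm ((t j * M + K) * exp (- (real (N j i) * r)))
        \<le> (t j * M + K) * exp (- (k * t j)) * exp (Y * r)"
        using tj MK by (simp add: abs_mult mult.assoc)
    qed
  qed
  define I where "I = {..<l} - {i0, i1}"
  have i01: "i0 \<noteq> i1" using i0 i1 by auto
  have split: "(\<Sum>i<l. f i) = f i0 + (\<Sum>i\<in>I. f i) + f i1" for f :: "nat \<Rightarrow> real"
  proof -
    have "{..<l} = insert i0 (insert i1 I)" using i0 i1 by (auto simp: I_def)
    moreover have "sum f (insert i0 (insert i1 I)) = f i0 + (f i1 + sum f I)"
      using i01 by (simp add: I_def)
    ultimately show ?thesis by simp
  qed
  define B where "B = (\<Sum>i<l. \<Sum>c<n. \<bar>b i c\<bar>)"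
  have B: "B \<ge> 0" by (auto simp: B_def intro!: sum_nonneg)
  have "tame_over Q B 1 (v i) (a i)" if i: "i \<in> I" for i
  proof -
    have il: "i < l" using i by (simp add: I_def)
    have "\<bar>b i c\<bar> \<le> B" for c
    proof (cases "c < n")
      case True
      have "\<bar>b i c\<bar> \<le> (\<Sum>c<n. \<bar>b i c\<bar>)" by (rule member_le_sum) (use True in auto)
      also have "\<dots> \<le> B" unfolding B_def by (rule member_le_sum) (use il in \<open>auto intro: sum_nonneg\<close>)
      finally show ?thesis .
    next
      case False
      then show ?thesis using p[OF il] QC B by (auto dest!: subsetD)
    qed
    then have "\<bar>b i c\<bar> \<le> 1 * B * max 1 (exp (a i))" for c
      using B mult_left_mono[of 1 "max 1 (exp (a i))" B] order_trans by fastforce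
    then show ?thesis using p[OF il] unfolding tame_over_def by blast
  qed
  then have "tame_over Q B (\<Sum>i\<in>I. real (N j i)) (\<lambda>c. \<Sum>i\<in>I. real (N j i) * v i c) (\<Sum>i\<in>I. real (N j i) * a i)" for j
    by (intro tame_over_multi_power[OF Q(1) B]) (auto simp: I_def)
  then have "\<forall>j. \<exists>\<beta>. (\<lambda>c. \<Sum>i\<in>I. real (N j i) * v i c, \<Sum>i\<in>I. real (N j i) * a i, \<beta>)
        \<in> insert (\<lambda>_. 0, 0, \<lambda>_. 0) Q \<and>
      (\<forall>c. \<bar>\<beta> c\<bar> \<le> (\<Sum>i\<in>I. real (N j i)) * B * max 1 (exp (\<Sum>i\<in>I. real (N j i) * a i)))"
    unfolding tame_over_def by blast
  from choice[OF this] obtain \<beta> where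
    \<beta>: "\<And>j. (\<lambda>c. \<Sum>i\<in>I. real (N j i) * v i c, \<Sum>i\<in>I. real (N j i) * a i, \<beta> j)
        \<in> insert (\<lambda>_. 0, 0, \<lambda>_. 0) Q"
    and \<beta>_le: "\<And>j c. \<bar>\<beta> j c\<bar>
        \<le> (\<Sum>i\<in>I. real (N j i)) * B * max 1 (exp (\<Sum>i\<in>I. real (N j i) * a i))"
    by blast
  define Aj where "Aj j = (\<Sum>i<l. real (N j i) * a i)" for j
  \<comment> \<open>\<open>D0 j\<close> is the dilation factor of the initial block of contractions, \<open>D1 j\<close> the inverse of that of
    the final block of expansions.\<close>
  define D0 D1 where "D0 j = exp (- (real (N j i0) * - a i0))" and "D1 j = exp (- (real (N j i1) * a i1))" for j
  have A_lim: "Aj \<longlonglongrightarrow> A" unfolding Aj_def A_def by (rule lim_sum) (rule bal_a)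
  define s where "s j = (\<lambda>c. \<Sum>i<l. real (N j i) * v i c, Aj j,
      \<lambda>c. (1 - D0 j) * x0 c + D0 j * \<beta> j c + (exp (Aj j) * D1 j - exp (Aj j)) * x1 c)" for j
  have s_Q: "s j \<in> Q" for j
  proof -
    define P0 where "P0 = (\<lambda>c. real (N j i0) * v i0 c, real (N j i0) * a i0, \<lambda>c. (1 - exp (real (N j i0) * a i0)) * x0 c)"
    define W where "W = (\<lambda>c. \<Sum>i\<in>I. real (N j i) * v i c, \<Sum>i\<in>I. real (N j i) * a i, \<beta> j)"
    define P1 where "P1 = (\<lambda>c. real (N j i1) * v i1 c, real (N j i1) * a i1, \<lambda>c. (1 - exp (real (N j i1) * a i1)) * x1 c)"
    have QQ: "g \<otimes>\<^bsub>H_group m n\<^esub> h \<in> Q" if "g \<in> Q" "h \<in> insert (\<lambda>_. 0, 0, \<lambda>_. 0) Q" for g h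
    proof (cases "h \<in> Q")
      case True
      then show ?thesis using that Q(1) by (auto simp: subsemigroup_def)
    next
      case False
      then have "h = (\<lambda>_. 0, 0, \<lambda>_. 0)" using that by simp
      then show ?thesis using that by (cases g) simp
    qed
    have P0: "P0 \<in> Q"
      unfolding P0_def x0_def by (rule power_of_homothety[OF Q(1) p]) (use i0 N_i0 in auto)
    have P1: "P1 \<in> insert (\<lambda>_. 0, 0, \<lambda>_. 0) Q"
    proof (cases "N j i1 \<ge> 1")
      case True
      then have "P1 \<in> Q" unfolding P1_def x1_def
        by (intro power_of_homothety[OF Q(1) p]) (use i1 in auto)
      then show ?thesis by simp
    next
      case False
      then have "N j i1 = 0" by simp
      then show ?thesis by (simp add: P1_def)
    qed
    have "(P0 \<otimes>\<^bsub>H_group m n\<^esub> W) \<otimes>\<^bsub>H_group m n\<^esub> P1 \<in> Q"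
      using P0 P1 \<beta>[of j] unfolding W_def by (intro QQ)
    also have "(P0 \<otimes>\<^bsub>H_group m n\<^esub> W) \<otimes>\<^bsub>H_group m n\<^esub> P1 = s j"
    proof -
      have e: "exp (real (N j i0) * a i0 + (\<Sum>i\<in>I. real (N j i) * a i)) * (1 - exp (real (N j i1) * a i1))
        = exp (Aj j) * D1 j - exp (Aj j)"
        unfolding Aj_def split D1_def right_diff_distrib by (simp flip: exp_add)
      have "D0 j = exp (real (N j i0) * a i0)" by (simp add: D0_def)
      then show ?thesis
        unfolding s_def P0_def P1_def W_def
        by (simp add: split[symmetric] Aj_def e[unfolded Aj_def] mult.assoc[symmetric])
          (simp add: split)
    qed
    finally show ?thesis .
  qed
  have D0: "D0 \<longlonglongrightarrow> 0"
    using decay[OF i0(1), of "- a i0" 0 1] i0(2) unfolding D0_def by simp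
  have D1: "D1 \<longlonglongrightarrow> 0"
    using decay[OF i1, of 0 1] unfolding D1_def by simp
  have D0\<beta>: "(\<lambda>j. D0 j * \<beta> j c) \<longlonglongrightarrow> 0" for c
  proof (rule Lim_null_comparison)
    define M where "M = (\<Sum>i<l. \<mu> i)"
    define K where "K = real l * Y"
    have M: "M \<ge> 0" unfolding M_def by (intro sum_nonneg) (use pos in \<open>auto simp: less_imp_le\<close>)
    have "Y \<ge> 0" by (auto simp: Y_def intro!: add_nonneg_nonneg sum_nonneg)
    then have K: "K \<ge> 0" by (simp add: K_def)
    have "(\<lambda>j. B * ((t j * M + K) * D0 j + exp (Aj j) * ((t j * M + K) * D1 j))) \<longlonglongrightarrow> B * (0 + exp A * 0)"
      unfolding D0_def D1_def using i0 i1 M K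
      by (intro tendsto_intros A_lim decay) auto
    then show "(\<lambda>j. B * ((t j * M + K) * D0 j + exp (Aj j) * ((t j * M + K) * D1 j))) \<longlonglongrightarrow> 0" by simp
    show "\<forall>\<^sub>F j in sequentially. norm (D0 j * \<beta> j c)
        \<le> B * ((t j * M + K) * D0 j + exp (Aj j) * ((t j * M + K) * D1 j))"
    proof (intro always_eventually allI)
      fix j
      define W where "W = (\<Sum>i\<in>I. real (N j i) * a i)"
      have "(\<Sum>i\<in>I. real (N j i)) \<le> (\<Sum>i<l. real (N j i))"
        by (rule sum_mono2) (auto simp: I_def)
      also have "\<dots> \<le> (\<Sum>i<l. t j * \<mu> i + Y)"
      proof (rule sum_mono)
        fix i assume "i \<in> {..<l}"
        then show "real (N j i) \<le> t j * \<mu> i + Y" using N1[of i j] by auto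
      qed
      also have "\<dots> = t j * M + K" by (simp add: M_def K_def sum.distrib sum_distrib_left)
      finally have L: "(\<Sum>i\<in>I. real (N j i)) \<le> t j * M + K" .
      have D0W: "D0 j * exp W = exp (Aj j) * D1 j"
        unfolding W_def D0_def D1_def Aj_def split by (simp flip: exp_add)
      have "D0 j * max 1 (exp W) \<le> D0 j + D0 j * exp W"
        by (auto simp: max_def D0_def algebra_simps)
      then have mx: "D0 j * max 1 (exp W) \<le> D0 j + exp (Aj j) * D1 j"
        by (simp only: D0W)
      have "norm (D0 j * \<beta> j c) = D0 j * \<bar>\<beta> j c\<bar>" by (simp add: abs_mult D0_def)
      also have "\<dots> \<le> D0 j * ((\<Sum>i\<in>I. real (N j i)) * B * max 1 (exp W))"
        unfolding W_def by (intro mult_left_mono \<beta>_le) (simp add: D0_def)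
      also have "\<dots> = (\<Sum>i\<in>I. real (N j i)) * B * (D0 j * max 1 (exp W))" by simp
      also have "\<dots> \<le> (t j * M + K) * B * (D0 j + exp (Aj j) * D1 j)"
        using B L by (intro mult_mono mx) (auto simp: D0_def sum_nonneg intro!: mult_nonneg_nonneg order_trans[OF _ L])
      finally show "norm (D0 j * \<beta> j c) \<le> B * ((t j * M + K) * D0 j + exp (Aj j) * ((t j * M + K) * D1 j))"
        by (simp add: algebra_simps)
    qed
  qed
  have "(\<lambda>j. (1 - D0 j) * x0 c + D0 j * \<beta> j c + (exp (Aj j) * D1 j - exp (Aj j)) * x1 c)
      \<longlonglongrightarrow> (1 - 0) * x0 c + 0 + (exp A * 0 - exp A) * x1 c" for c
    by (intro tendsto_intros D0 D1 D0\<beta> A_lim)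
  then have "s \<longlonglongrightarrow> (V, A, \<lambda>c. x0 c - exp A * x1 c)"
    unfolding s_def V_def
    by (intro tendsto_Pair A_lim tendsto_fun_iff[THEN iffD2] allI lim_sum bal_v) simp
  moreover have "(V, A, \<lambda>c. x0 c - exp A * x1 c) \<in> carrier (H_group m n)"
  proof -
    have "(\<forall>c\<ge>m - 1. v i c = 0) \<and> (\<forall>c\<ge>n. b i c = 0)" if "i < l" for i
      using p[OF that] QC by (auto dest!: subsetD)
    then show ?thesis using i0 i1 by (simp add: V_def x0_def x1_def)
  qed
  ultimately have "limitin (H_topology m n) s (V, A, \<lambda>c. x0 c - exp A * x1 c) sequentially"
    using s_Q QC by (auto simp: H_topology_eq limitin_subtopology intro!: always_eventually)
  from limitin_closedin[OF this Q(2)]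
  have "(V, A, \<lambda>c. x0 c - exp A * x1 c) \<in> Q" using s_Q by simp
  then show ?thesis by (simp add: V_def A_def x0_def x1_def)
qed

text \<open>
  Let \<open>y\<close> be the fixed point of an expanding letter and let \<open>X\<close> be the set of points \<open>x\<close> such that \<open>Q\<close>
  contains all maps \<open>z \<mapsto> x + exp a * (z - y)\<close>, with arbitrary dilation factor and arbitrary central
  part \<open>v\<close>. By the limits of words, \<open>X\<close> contains the fixed point of a contracting letter. It is mapped
  into itself by the elements of \<open>Q\<close>, and multiplying two of the maps above shows that it contains
  \<open>x + r (x' - y)\<close> whenever it contains \<open>x\<close> and \<open>x'\<close> and \<open>r > 0\<close>. Hence the positive multiples of
  \<open>X - y\<close> form a convex cone. If this cone were proper, some linear functional would be bounded below
  on \<open>X\<close>, and the half-space cut out by its infimum would be mapped into itself by every letter. Thus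
  the cone is everything, so \<open>X\<close> meets both rays from \<open>y\<close> in every direction, and starting from a point on
  one ray and adding multiples of a point on the other gives the whole line.\<close>
lemma closed_subsemigroup_eq_carrier:
  fixes v b :: "nat \<Rightarrow> nat \<Rightarrow> real" and a \<mu> :: "nat \<Rightarrow> real"
  assumes Q: "subsemigroup (H_group m n) Q" "closedin (H_topology m n) Q"
    and p: "\<And>i. i < l \<Longrightarrow> (v i, a i, b i) \<in> Q"
    and ind: "\<And>c::nat \<Rightarrow> int. (\<Sum>i<l. of_int (c i) * \<mu> i) = 0 \<Longrightarrow> (\<forall>i<l. c i = 0)"
    and pos: "\<And>i. i < l \<Longrightarrow> \<mu> i > 0"
    and bal_v: "\<And>c. (\<Sum>i<l. \<mu> i * v i c) = 0" and bal_a: "(\<Sum>i<l. \<mu> i * a i) = 0"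
    and span: "\<And>v' a'. \<forall>c\<ge>m - 1. v' c = 0 \<Longrightarrow>
      \<exists>y. (\<forall>c. (\<Sum>i<l. y i * v i c) = v' c) \<and> (\<Sum>i<l. y i * a i) = a'"
    and contr: "\<exists>i<l. a i < 0" and expand: "\<exists>i<l. a i > 0"
    and moved: "\<And>\<phi> c. \<exists>k<n. \<phi> k \<noteq> 0 \<Longrightarrow> \<exists>i<l. (\<Sum>k<n. \<phi> k * b i k) + c * (exp (a i) - 1) < 0"
  shows "Q = carrier (H_group m n)"
proof -
  have QC: "Q \<subseteq> carrier (H_group m n)" using Q(1) by (simp add: subsemigroup_def)
  have mult_in: "(\<lambda>i. v i + v' i, a + a', \<lambda>i. b i + exp a * b' i) \<in> Q"
    if "(v, a, b) \<in> Q" "(v', a', b') \<in> Q" for v a b v' a' b'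
  proof -
    have "(v, a, b) \<otimes>\<^bsub>H_group m n\<^esub> (v', a', b') \<in> Q"
      using that Q(1) unfolding subsemigroup_def by blast
    then show ?thesis by simp
  qed
  obtain i0 where i0: "i0 < l" "a i0 < 0" using contr by blast
  obtain i1 where i1: "i1 < l" "a i1 > 0" using expand by blast
  define y where "y = (\<lambda>c. b i1 c / (1 - exp (a i1)))"
  define x0 where "x0 = (\<lambda>c. b i0 c / (1 - exp (a i0)))"
  have y_supp: "y c = 0" if "c \<ge> n" for c
    using p[OF i1(1)] QC that by (auto simp: y_def dest!: subsetD)
  define X where "X = {x. \<forall>v a. (\<forall>c\<ge>m - 1. v c = 0) \<longrightarrow> (v, a, \<lambda>c. x c - exp a * y c) \<in> Q}"
  have XD: "(v', a', \<lambda>c. x c - exp a' * y c) \<in> Q" if "x \<in> X" "\<forall>c\<ge>m - 1. v' c = 0" for x v' a'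
    using that by (auto simp: X_def)
  have x0: "x0 \<in> X"
    unfolding X_def
  proof (intro CollectI allI impI)
    fix v' :: "nat \<Rightarrow> real" and a' assume "\<forall>c\<ge>m - 1. v' c = 0"
    then obtain w where w: "\<And>c. (\<Sum>i<l. w i * v i c) = v' c" "(\<Sum>i<l. w i * a i) = a'"
      using span by blast
    show "(v', a', \<lambda>c. x0 c - exp a' * y c) \<in> Q"
      using limit_of_words[OF Q p ind pos bal_v bal_a i0 i1, of w]
      unfolding w x0_def y_def .
  qed
  have X_supp: "x c = 0" if "x \<in> X" "c \<ge> n" for x c
    using XD[OF that(1), of "\<lambda>_. 0" 0] QC y_supp that by (auto dest!: subsetD)
  have X_inv: "(\<lambda>c. bs c + exp as * x c) \<in> X" if s: "(vs, as, bs) \<in> Q" and x: "x \<in> X" for vs as bs x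
    unfolding X_def
  proof (intro CollectI allI impI)
    fix v' :: "nat \<Rightarrow> real" and a' assume v': "\<forall>c\<ge>m - 1. v' c = 0"
    have "\<forall>c\<ge>m - 1. vs c = 0" using s QC by (auto dest!: subsetD)
    with v' have "(\<lambda>c. v' c - vs c, a' - as, \<lambda>c. x c - exp (a' - as) * y c) \<in> Q"
      by (intro XD[OF x]) auto
    from mult_in[OF s this] show "(v', a', \<lambda>c. bs c + exp as * x c - exp a' * y c) \<in> Q"
      by (simp add: algebra_simps exp_diff)
  qed
  have X_ray: "(\<lambda>c. x c + r * (x' c - y c)) \<in> X" if x: "x \<in> X" "x' \<in> X" and r: "r > 0" for x x' r
    unfolding X_def
  proof (intro CollectI allI impI)
    fix v' :: "nat \<Rightarrow> real" and a' assume v': "\<forall>c\<ge>m - 1. v' c = 0"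
    \<comment> \<open>The factor \<open>r\<close> is the dilation factor of the left one of the two maps.\<close>
    have 1: "(\<lambda>_. 0, ln r, \<lambda>c. x c - r * y c) \<in> Q"
      using XD[OF x(1), of "\<lambda>_. 0" "ln r"] r by simp
    have 2: "(v', a' - ln r, \<lambda>c. x' c - exp a' / r * y c) \<in> Q"
      using XD[OF x(2) v', of "a' - ln r"] r by (simp add: exp_diff)
    have eq: "(\<lambda>c. x c - r * y c + exp (ln r) * (x' c - exp a' / r * y c))
        = (\<lambda>c. x c + r * (x' c - y c) - exp a' * y c)"
      using r by (intro ext) (simp add: field_simps)
    from mult_in[OF 1 2] show "(v', a', \<lambda>c. x c + r * (x' c - y c) - exp a' * y c) \<in> Q"
      unfolding eq by simp
  qed
  define K where "K = {\<lambda>c. r * (x c - y c) | r x. r > 0 \<and> x \<in> X}"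
  have KI: "(\<lambda>c. r * (x c - y c)) \<in> K" if "r > 0" "x \<in> X" for r x
    using that by (auto simp: K_def)
  have "\<exists>u\<in>K. \<forall>c<n. u c = w c" for w
  proof (rule ccontr)
    assume no: "\<not> ?thesis"
    have "\<exists>\<phi>. (\<exists>k<n. \<phi> k \<noteq> 0) \<and> (\<forall>u\<in>K. 0 \<le> (\<Sum>k<n. \<phi> k * u k))"
    proof (rule convex_cone_in_halfspace)
      fix u u' assume "u \<in> K" "u' \<in> K"
      then obtain r x r' x' where u: "u = (\<lambda>c. r * (x c - y c))" "r > 0" "x \<in> X"
        and u': "u' = (\<lambda>c. r' * (x' c - y c))" "r' > 0" "x' \<in> X" by (auto simp: K_def)
      have "u c + u' c = r * ((x c + r' / r * (x' c - y c)) - y c)" for c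
        using u(2) by (simp add: u(1) u'(1) field_simps)
      moreover have "(\<lambda>c. x c + r' / r * (x' c - y c)) \<in> X"
        using u u' by (intro X_ray) auto
      ultimately show "(\<lambda>c. u c + u' c) \<in> K"
        using KI[OF u(2)] by simp
    next
      fix t :: real and u assume t: "t > 0" and "u \<in> K"
      then obtain r x where u: "u = (\<lambda>c. r * (x c - y c))" "r > 0" "x \<in> X" by (auto simp: K_def)
      then have "(\<lambda>c. t * u c) = (\<lambda>c. (t * r) * (x c - y c))" "t * r > 0"
        using t by (auto simp: algebra_simps)
      then show "(\<lambda>c. t * u c) \<in> K"
        using KI[OF _ u(3)] by simp
    next
      show "K \<noteq> {}" using KI[OF zero_less_one x0] by blast
    next
      show "\<exists>i<n. u i \<noteq> w i" if "u \<in> K" for u using no that by blast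
    qed
    then obtain \<phi> where \<phi>: "\<exists>k<n. \<phi> k \<noteq> 0"
      and pos_K: "\<And>u. u \<in> K \<Longrightarrow> 0 \<le> (\<Sum>k<n. \<phi> k * u k)" by blast
    define \<Phi> where "\<Phi> x = (\<Sum>k<n. \<phi> k * x k)" for x
    have low: "\<Phi> y \<le> \<Phi> x" if "x \<in> X" for x
    proof -
      from pos_K[OF KI[OF zero_less_one that]] show ?thesis
        by (simp add: \<Phi>_def algebra_simps sum_subtractf)
    qed
    define \<gamma> where "\<gamma> = Inf (\<Phi> ` X)"
    have \<gamma>_le: "\<gamma> \<le> \<Phi> x" if "x \<in> X" for x
      unfolding \<gamma>_def by (rule cINF_lower) (use low that in \<open>auto intro!: bdd_belowI[of _ "\<Phi> y"]\<close>)
    obtain i where i: "i < l" and neg: "\<Phi> (b i) + \<gamma> * (exp (a i) - 1) < 0"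
      using moved[OF \<phi>, of \<gamma>] by (auto simp: \<Phi>_def)
    have "(\<gamma> - \<Phi> (b i)) / exp (a i) \<le> \<gamma>"
    proof (subst (2) \<gamma>_def, rule cINF_greatest)
      show "X \<noteq> {}" using x0 by blast
      fix x assume x: "x \<in> X"
      have "\<gamma> \<le> \<Phi> (\<lambda>c. b i c + exp (a i) * x c)"
        by (intro \<gamma>_le X_inv[OF p[OF i] x])
      also have "\<dots> = \<Phi> (b i) + exp (a i) * \<Phi> x"
        by (simp add: \<Phi>_def sum.distrib sum_distrib_left algebra_simps)
      finally show "(\<gamma> - \<Phi> (b i)) / exp (a i) \<le> \<Phi> x" by (simp add: field_simps)
    qed
    then show False using neg by (simp add: field_simps)
  qed
  then have K_all: "\<exists>r>0. \<exists>x\<in>X. \<forall>c<n. r * (x c - y c) = w c" for w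
    unfolding K_def by blast
  have X_all: "x \<in> X" if x: "\<forall>c\<ge>n. x c = 0" for x
  proof -
    obtain r1 x1 where 1: "r1 > 0" "x1 \<in> X" "\<And>c. c < n \<Longrightarrow> r1 * (x1 c - y c) = x c - y c"
      using K_all[of "\<lambda>c. x c - y c"] by blast
    obtain r2 x2 where 2: "r2 > 0" "x2 \<in> X" "\<And>c. c < n \<Longrightarrow> r2 * (x2 c - y c) = - (x c - y c)"
      using K_all[of "\<lambda>c. - (x c - y c)"] by blast
    \<comment> \<open>In units of \<open>x - y\<close>, the point \<open>x2\<close> lies at \<open>- 1 / r2\<close> and \<open>x1\<close> at \<open>1 / r1\<close>; the multiple is chosen to
    arrive at \<open>1\<close>.\<close>
    have "(\<lambda>c. x2 c + r1 * (1 + 1 / r2) * (x1 c - y c)) \<in> X"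
      using 1 2 by (intro X_ray) (auto intro!: mult_pos_pos add_pos_pos)
    also have "(\<lambda>c. x2 c + r1 * (1 + 1 / r2) * (x1 c - y c)) = x"
    proof
      fix c
      show "x2 c + r1 * (1 + 1 / r2) * (x1 c - y c) = x c"
      proof (cases "c < n")
        case True
        have "x2 c = y c - (x c - y c) / r2" using 2(1) 2(3)[OF True] by (simp add: field_simps)
        moreover have "r1 * (1 + 1 / r2) * (x1 c - y c) = (1 + 1 / r2) * (x c - y c)"
          using 1(3)[OF True] by (simp add: mult.commute mult.left_commute)
        ultimately show ?thesis using 2(1) by (simp add: field_simps)
      next
        case False
        then show ?thesis using X_supp[OF 1(2)] X_supp[OF 2(2)] y_supp x by simp
      qed
    qed
    finally show ?thesis .
  qed
  have "(v', a', b') \<in> Q" if "(v', a', b') \<in> carrier (H_group m n)" for v' a' b'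
    using XD[OF X_all[of "\<lambda>c. b' c + exp a' * y c"], of v' a'] that y_supp by simp
  then show ?thesis using QC by auto
qed

section \<open>Perturbation by fractional powers\<close>

text \<open>
  The power of \<open>x \<mapsto> b + exp a * x\<close> with real exponent \<open>\<sigma>\<close>, taken in the one-parameter group through
  this map, has this multiple of \<open>b\<close> as its translation part.\<close>
definition fractional_factor :: "real \<Rightarrow> real \<Rightarrow> real" where
  "fractional_factor \<sigma> a = (if a = 0 then \<sigma> else (exp (\<sigma> * a) - 1) / (exp a - 1))"

lemma fractional_factor_pos: "\<sigma> > 0 \<Longrightarrow> fractional_factor \<sigma> a > 0"
  by (cases "a > 0") (auto simp: fractional_factor_def divide_pos_pos mult_pos_neg divide_neg_neg)

lemma exp_fractional: "exp (\<sigma> * a) - 1 = fractional_factor \<sigma> a * (exp a - 1)"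
  by (simp add: fractional_factor_def)

lemma tendsto_fractional_factor:
  assumes "(f \<longlongrightarrow> 1) F"
  shows "((\<lambda>j. fractional_factor (f j) a) \<longlongrightarrow> 1) F"
proof (cases "a = 0")
  case True
  then show ?thesis using assms by (simp add: fractional_factor_def)
next
  case False
  have "((\<lambda>j. (exp (f j * a) - 1) / (exp a - 1)) \<longlongrightarrow> (exp (1 * a) - 1) / (exp a - 1)) F"
    using False by (intro tendsto_intros assms) simp
  then show ?thesis using False by (simp add: fractional_factor_def)
qed

text \<open>
  The perturbation replaces each entry by a fractional power of itself with an exponent
  \<open>\<mu>0 i / \<mu> i\<close> close to \<open>1\<close>. Positive powers leave invariant the same half-spaces and take negative
  values under the same characters, so the two families of inequalities that express
  nonseparatedness survive. The exponents are chosen such that the positive relation between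
  the entries in the abelianisation gets rationally independent weights.\<close>
lemma nonseparated_tuple_in_closure:
  assumes m: "m \<ge> 1" and p: "p \<in> nonseparated_tuples (H_group m n) (H_topology m n) l"
  shows "p \<in> tuple_topology (H_topology m n) l closure_of
    (multiplicatively_dense_tuples (H_group m n) (H_topology m n) l)"
proof -
  let ?C = "carrier (H_group m n)"
  have pT: "p \<in> topspace (tuple_topology (H_topology m n) l)"
    and ns: "nonseparated (H_group m n) (H_topology m n) (p ` {..<l})"
    using p by (auto simp: nonseparated_tuples_def)
  have top: "topspace (tuple_topology (H_topology m n) l) = {..<l} \<rightarrow>\<^sub>E ?C"
    by (simp add: tuple_topology_def topspace_H_topology)
  have pC: "p i \<in> ?C" if "i < l" for i using pT that by (auto simp: top)
  then have imC: "p ` {..<l} \<subseteq> ?C" by auto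
  define v a b where "v i = fst (p i)" and "a i = fst (snd (p i))" and "b i = snd (snd (p i))" for i
  have p_eq: "p i = (v i, a i, b i)" for i by (simp add: v_def a_def b_def)
  have v_supp: "v i c = 0" if "i < l" "c \<ge> m - 1" for i c
    using pC[OF that(1)] that(2) by (simp add: p_eq)
  have b_supp: "b i c = 0" if "i < l" "c \<ge> n" for i c
    using pC[OF that(1)] that(2) by (simp add: p_eq)
  have A: "\<exists>i<l. (\<Sum>k<m - 1. \<xi> k * v i k) + c * a i < 0" if "(\<exists>i<m - 1. \<xi> i \<noteq> 0) \<or> c \<noteq> 0" for \<xi> c
    using nonseparated_imp_negative_character[OF ns imC that] by (auto simp: p_eq)
  have B: "\<exists>i<l. (\<Sum>k<n. \<phi> k * b i k) + c * (exp (a i) - 1) < 0" if "\<exists>i<n. \<phi> i \<noteq> 0" for \<phi> c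
    using nonseparated_imp_halfspace_moved[OF ns imC that, of c] by (auto simp: p_eq)
  have contr: "\<exists>i<l. a i < 0" using A[of "\<lambda>_. 0" 1] by simp
  have expand: "\<exists>i<l. a i > 0" using A[of "\<lambda>_. 0" "-1"] by simp
  \<comment> \<open>The image of the entry in the abelianisation, written as a vector with \<open>m\<close> coordinates.\<close>
  define u where "u i c = (if c < m - 1 then v i c else a i)" for i c
  have sum_m: "(\<Sum>c<m. f c) = (\<Sum>c<m - 1. f c) + f (m - 1)" for f :: "nat \<Rightarrow> real"
    using m sum.lessThan_Suc[of f "m - 1"] by simp
  have comb: "\<exists>w. (\<forall>i<l. w i > 0) \<and> (\<forall>c. (\<Sum>i<l. w i * v i c) = v' c) \<and> (\<Sum>i<l. w i * a i) = a'"
    if v': "\<forall>c\<ge>m - 1. v' c = 0" for v' a'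
  proof -
    have "\<exists>w. (\<forall>i<l. w i > 0) \<and> (\<forall>c<m. (\<Sum>i<l. w i * u i c) = (if c < m - 1 then v' c else a'))"
    proof (rule strictly_positive_combination)
      fix \<xi> :: "nat \<Rightarrow> real" assume "\<exists>c<m. \<xi> c \<noteq> 0"
      then have "(\<exists>i<m - 1. \<xi> i \<noteq> 0) \<or> \<xi> (m - 1) \<noteq> 0"
        by (metis Suc_pred' less_Suc_eq m less_eq_Suc_le One_nat_def)
      from A[OF this] show "\<exists>i<l. (\<Sum>c<m. \<xi> c * u i c) < 0"
        by (simp add: sum_m u_def)
    qed
    then obtain w where w: "\<forall>i<l. w i > 0"
      and wc: "\<And>c. c < m \<Longrightarrow> (\<Sum>i<l. w i * u i c) = (if c < m - 1 then v' c else a')" by blast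
    have "(\<Sum>i<l. w i * v i c) = v' c" for c
    proof (cases "c < m - 1")
      case True
      then show ?thesis using wc[of c] by (simp add: u_def)
    next
      case False
      then show ?thesis using v_supp v' by simp
    qed
    moreover have "(\<Sum>i<l. w i * a i) = a'" using wc[of "m - 1"] m by (simp add: u_def)
    ultimately show ?thesis using w by blast
  qed
  obtain \<mu>0 where \<mu>0: "\<And>i. i < l \<Longrightarrow> \<mu>0 i > 0" "\<And>c. (\<Sum>i<l. \<mu>0 i * v i c) = 0"
    "(\<Sum>i<l. \<mu>0 i * a i) = 0"
    using comb[of "\<lambda>_. 0" 0] by auto
  have "\<forall>j. \<exists>\<mu>. (\<forall>i<l. \<mu>0 i < \<mu> i \<and> \<mu> i < \<mu>0 i + 1 / (real j + 1)) \<and>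
     (\<forall>c::nat \<Rightarrow> int. (\<Sum>i<l. of_int (c i) * \<mu> i) = 0 \<longrightarrow> (\<forall>i<l. c i = 0))"
    by (intro allI integrally_independent_near) simp
  from choice[OF this] obtain \<mu> where
    \<mu>: "\<And>j i. i < l \<Longrightarrow> \<mu>0 i < \<mu> j i \<and> \<mu> j i < \<mu>0 i + 1 / (real j + 1)"
    and ind: "\<And>j (c::nat \<Rightarrow> int). (\<Sum>i<l. of_int (c i) * \<mu> j i) = 0 \<Longrightarrow> (\<forall>i<l. c i = 0)"
    by blast
  define \<sigma> where "\<sigma> j i = \<mu>0 i / \<mu> j i" for j i
  have \<mu>_pos: "\<mu> j i > 0" if "i < l" for i j using \<mu>[OF that, of j] \<mu>0(1)[OF that] by linarith
  have \<sigma>_pos: "\<sigma> j i > 0" if "i < l" for i j using \<mu>_pos[OF that] \<mu>0(1)[OF that] by (simp add: \<sigma>_def)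
  have \<mu>\<sigma>: "\<mu> j i * \<sigma> j i = \<mu>0 i" if "i < l" for i j
    using \<mu>_pos[OF that, of j] by (simp add: \<sigma>_def)
  have \<sigma>_lim: "(\<lambda>j. \<sigma> j i) \<longlonglongrightarrow> 1" if i: "i < l" for i
  proof -
    have "(\<lambda>j. \<mu> j i) \<longlonglongrightarrow> \<mu>0 i"
    proof (rule tendsto_sandwich[where f = "\<lambda>_. \<mu>0 i" and h = "\<lambda>j. \<mu>0 i + 1 / (real j + 1)"])
      show "(\<lambda>j. \<mu>0 i + 1 / (real j + 1)) \<longlonglongrightarrow> \<mu>0 i" by real_asymp
    qed (use \<mu>[OF i] in \<open>auto intro!: always_eventually less_imp_le\<close>)
    then have "(\<lambda>j. \<sigma> j i) \<longlonglongrightarrow> \<mu>0 i / \<mu>0 i"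
      unfolding \<sigma>_def using \<mu>0(1)[OF i] by (intro tendsto_intros) auto
    then show ?thesis using \<mu>0(1)[OF i] by simp
  qed
  define v' a' b' where "v' j i = (\<lambda>c. \<sigma> j i * v i c)" and "a' j i = \<sigma> j i * a i"
    and "b' j i = (\<lambda>c. fractional_factor (\<sigma> j i) (a i) * b i c)" for j i
  define p' where "p' j = (\<lambda>i\<in>{..<l}. (v' j i, a' j i, b' j i))" for j
  have p'C: "p' j i \<in> ?C" if "i < l" for i j
    using that v_supp b_supp by (simp add: p'_def v'_def b'_def)
  then have p'T: "p' j \<in> topspace (tuple_topology (H_topology m n) l)" for j
    by (auto simp: top p'_def)
  have dense: "p' j \<in> multiplicatively_dense_tuples (H_group m n) (H_topology m n) l" for j
  proof -
    define S where "S = subsemigroup (H_group m n) hull (p' j ` {..<l})"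
    define Q where "Q = H_topology m n closure_of S"
    have "p' j ` {..<l} \<subseteq> ?C" using p'C by auto
    moreover have "subsemigroup (H_group m n) ?C"
      using group.subgroup_self[OF group_H_group] by (auto simp: subsemigroup_def)
    ultimately have S: "subsemigroup (H_group m n) S"
      unfolding S_def hull_def subsemigroup_def by blast
    have p'Q: "(v' j i, a' j i, b' j i) \<in> Q" if "i < l" for i
    proof -
      have "p' j i \<in> S" unfolding S_def using that by (intro hull_inc) auto
      moreover have "S \<subseteq> Q"
        unfolding Q_def using S by (intro closure_of_subset) (simp add: topspace_H_topology subsemigroup_def)
      ultimately show ?thesis using that by (auto simp: p'_def)
    qed
    have "Q = ?C"
    proof (rule closed_subsemigroup_eq_carrier[where \<mu> = "\<mu> j" and v = "v' j" and a = "a' j" and b = "b' j" and l = l])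
      show "subsemigroup (H_group m n) Q" unfolding Q_def by (rule subsemigroup_closure_of[OF S])
      show "closedin (H_topology m n) Q" unfolding Q_def by simp
      show "(\<Sum>i<l. \<mu> j i * v' j i c) = 0" for c
      proof -
        have "(\<Sum>i<l. \<mu> j i * v' j i c) = (\<Sum>i<l. \<mu>0 i * v i c)"
          by (intro sum.cong) (simp_all add: v'_def \<mu>\<sigma> flip: mult.assoc)
        then show ?thesis using \<mu>0 by simp
      qed
      show "(\<Sum>i<l. \<mu> j i * a' j i) = 0"
      proof -
        have "(\<Sum>i<l. \<mu> j i * a' j i) = (\<Sum>i<l. \<mu>0 i * a i)"
          by (intro sum.cong) (simp_all add: a'_def \<mu>\<sigma> flip: mult.assoc)
        then show ?thesis using \<mu>0 by simp
      qed
      show "\<exists>y. (\<forall>c. (\<Sum>i<l. y i * v' j i c) = w c) \<and> (\<Sum>i<l. y i * a' j i) = r"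
        if w: "\<forall>c\<ge>m - 1. w c = 0" for w r
      proof -
        obtain z where z: "\<And>c. (\<Sum>i<l. z i * v i c) = w c" "(\<Sum>i<l. z i * a i) = r"
          using comb[OF w] by blast
        have "(\<Sum>i<l. z i / \<sigma> j i * v' j i c) = w c" for c
          unfolding z(1)[symmetric] using \<sigma>_pos
          by (intro sum.cong) (auto simp: v'_def less_imp_neq[THEN not_sym])
        moreover have "(\<Sum>i<l. z i / \<sigma> j i * a' j i) = r"
          unfolding z(2)[symmetric] using \<sigma>_pos
          by (intro sum.cong) (auto simp: a'_def less_imp_neq[THEN not_sym])
        ultimately show ?thesis by (intro exI[of _ "\<lambda>i. z i / \<sigma> j i"]) simp
      qed
      show "\<exists>i<l. a' j i < 0" using contr \<sigma>_pos by (auto simp: a'_def mult_pos_neg)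
      show "\<exists>i<l. a' j i > 0" using expand \<sigma>_pos by (auto simp: a'_def)
      show "\<exists>i<l. (\<Sum>k<n. \<phi> k * b' j i k) + c * (exp (a' j i) - 1) < 0"
        if \<phi>: "\<exists>k<n. \<phi> k \<noteq> 0" for \<phi> c
      proof -
        obtain i where i: "i < l" and neg: "(\<Sum>k<n. \<phi> k * b i k) + c * (exp (a i) - 1) < 0"
          using B[OF \<phi>] by blast
        let ?E = "fractional_factor (\<sigma> j i) (a i)"
        have "exp (a' j i) - 1 = ?E * (exp (a i) - 1)"
          unfolding a'_def by (rule exp_fractional)
        moreover have "(\<Sum>k<n. \<phi> k * b' j i k) = ?E * (\<Sum>k<n. \<phi> k * b i k)"
          by (simp add: b'_def sum_distrib_left mult.left_commute)
        ultimately have "(\<Sum>k<n. \<phi> k * b' j i k) + c * (exp (a' j i) - 1)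
            = ?E * ((\<Sum>k<n. \<phi> k * b i k) + c * (exp (a i) - 1))"
          by (simp only: distrib_left mult.left_commute)
        also have "\<dots> < 0"
          by (intro mult_pos_neg neg fractional_factor_pos \<sigma>_pos i)
        finally show ?thesis using i by blast
      qed
    qed (use ind \<mu>_pos p'Q in auto)
    then show ?thesis
      using p'T by (simp add: multiplicatively_dense_tuples_def multiplicatively_dense_def
          Q_def S_def)
  qed
  have "limitin (tuple_topology (H_topology m n) l) p' p sequentially"
    unfolding tuple_topology_def limitin_componentwise
  proof (intro conjI ballI)
    show "p \<in> extensional {..<l}" using pT by (auto simp: top PiE_def)
    show "\<forall>\<^sub>F j in sequentially. p' j \<in> topspace (product_topology (\<lambda>_. H_topology m n) {..<l})"
      using p'T by (simp add: tuple_topology_def)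
    fix i assume "i \<in> {..<l}"
    then have i: "i < l" by simp
    have "(\<lambda>j. (v' j i, a' j i, b' j i)) \<longlonglongrightarrow> (\<lambda>c. 1 * v i c, 1 * a i, \<lambda>c. 1 * b i c)"
      unfolding v'_def a'_def b'_def
      by (intro tendsto_Pair tendsto_fun_iff[THEN iffD2] allI tendsto_intros \<sigma>_lim[OF i]
          tendsto_fractional_factor)
    then have "(\<lambda>j. p' j i) \<longlonglongrightarrow> p i" using i by (simp add: p'_def p_eq)
    then show "limitin (H_topology m n) (\<lambda>j. p' j i) (p i) sequentially"
      using p'C[OF i] pC[OF i] by (simp add: H_topology_eq limitin_subtopology)
  qed
  moreover have "\<forall>\<^sub>F j in sequentially. p' j \<in> tuple_topology (H_topology m n) l closure_of
      multiplicatively_dense_tuples (H_group m n) (H_topology m n) l"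
  proof (intro always_eventually allI subsetD[OF closure_of_subset] dense)
    show "multiplicatively_dense_tuples (H_group m n) (H_topology m n) l
        \<subseteq> topspace (tuple_topology (H_topology m n) l)"
      by (auto simp: multiplicatively_dense_tuples_def)
  qed
  ultimately show ?thesis
    by (rule limitin_closedin[OF _ closedin_closure_of]) simp
qed

theorem theorem2p16:
  fixes m n l :: nat
  assumes "m \<ge> 1" and "n \<ge> 1" and "l \<ge> 1"
  shows "multiplicatively_dense_tuples (H_group m n) (H_topology m n) l
           \<subseteq> nonseparated_tuples (H_group m n) (H_topology m n) l
         \<and> subtopology (tuple_topology (H_topology m n) l)
               (nonseparated_tuples (H_group m n) (H_topology m n) l)
             closure_of (multiplicatively_dense_tuples (H_group m n) (H_topology m n) l)
           = nonseparated_tuples (H_group m n) (H_topology m n) l"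
proof
  let ?N = "nonseparated_tuples (H_group m n) (H_topology m n) l"
  let ?D = "multiplicatively_dense_tuples (H_group m n) (H_topology m n) l"
  show sub: "?D \<subseteq> ?N"
  proof
    fix p assume p: "p \<in> ?D"
    then have "p \<in> {..<l} \<rightarrow>\<^sub>E carrier (H_group m n)"
      by (simp add: multiplicatively_dense_tuples_def tuple_topology_def topspace_H_topology)
    then have "p ` {..<l} \<subseteq> carrier (H_group m n)" by (auto simp: PiE_iff)
    then show "p \<in> ?N"
      using p multiplicatively_dense_imp_nonseparated[of "p ` {..<l}" m n]
      by (simp add: multiplicatively_dense_tuples_def nonseparated_tuples_def)
  qed
  have "?N \<subseteq> tuple_topology (H_topology m n) l closure_of ?D"
    using nonseparated_tuple_in_closure[OF assms(1)] by blast
  then show "subtopology (tuple_topology (H_topology m n) l) ?N closure_of ?D = ?N"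
    using sub by (simp add: closure_of_subtopology inf.absorb2 inf.absorb1)
qed

end
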